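(* Let $N,d\ge 1$, $t_0<T$, and let $K$ be a radial potential on $\mathbb{R}^d$ with $\nabla K\in W^{1,\infty}(\mathbb{R}^d)$. Consider a point $(\mathbf{x}_0,\mathbf{v}_0)\in\mathbb{R}^{2Nd}$ and suppose that the first-order model $$\frac{dx_i}{dt}=v_i,\qquad v_i=-\frac1N\sum_{j\neq i}\nabla_{x_i}K(x_i-x_j),\qquad i=1,\dots,N,$$ has a solution $\mathbf{x}(t)=(x_1(t),\dots,x_N(t))\in\mathbb{R}^{Nd}$ with $\mathbf{x}(t_0)=\mathbf{x}_0$ for $t\in[t_0,T]$. Define $\mathbf{v}(t)=(v_1(t),\dots,v_N(t))$ by $v_i(t)=-\frac1N\sum_{j\ne i}\nabla_{x_i}K(x_i(t)-x_j(t))$. For $\epsilon>0$ let $(\mathbf{x}_\epsilon(t),\mathbf{v}_\epsilon(t))\in\mathbb{R}^{2Nd}$ be the solution of the second-order model $$\frac{dx_i}{dt}=v_i,\qquad \epsilon\frac{dv_i}{dt}=-v_i-\frac1N\sum_{j\neq i}\nabla_{x_i}K(x_i-x_j),\qquad i=1,\dots,N,$$ with $(\mathbf{x}_\epsilon(t_0),\mathbf{v}_\epsilon(t_0))=(\mathbf{x}_0,\mathbf{v}_0)$. Then, as $\epsilon\to0$, $(\mathbf{x}_\epsilon(t),\mathbf{v}_\epsilon(t))$ converges to $(\mathbf{x}(t),\mathbf{v}(t))$ in the following sense: for some $T^*<T$, (i) $\lim_{\epsilon\to0}\mathbf{v}_\epsilon(t)=\mathbf{v}(t)$ for all $t\in(t_0,T^*]$,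 and (ii) $\lim_{\epsilon\to0}\mathbf{x}_\epsilon(t)=\mathbf{x}(t)$ for all $t\in[t_0,T^*]$. The convergence of $\mathbf{v}_\epsilon(t)$ does not hold at the initial time $t_0$, unless $\mathbf{v}_0=(v_{0,1},\dots,v_{0,N})$ and $\mathbf{x}_0=(x_{0,1},\dots,x_{0,N})$ are related by $v_{0,i}=-\frac1N\sum_{j\ne i}\nabla_{x_i}K(x_{0,i}-x_{0,j})$ for all $i$.
   Context: Positions $x_i$ and velocities $v_i$ take values in $\mathbb{R}^d$; $\mathbf{x}=(x_1,\dots,x_N)$ and $\mathbf{v}=(v_1,\dots,v_N)$ are the concatenated vectors in $\mathbb{R}^{Nd}$. "Radial" means that $K(x)$ depends only on $|x|$. $\nabla_{x_i}K(x_i-x_j)$ is the gradient of $K$ evaluated at $x_i-x_j$. Sums run over $j\in\{1,\dots,N\}\setminus\{i\}$. Of $T^*$ it is only required that $t_0<T^*<T$. *)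

theory Defs
  imports "HOL-Analysis.Analysis"
begin

definition radial :: "('a::real_normed_vector \<Rightarrow> real) \<Rightarrow> bool" where
  "radial K \<longleftrightarrow> (\<exists>k. \<forall>x. K x = k (norm x))"

definition grad :: "('a::real_inner \<Rightarrow> real) \<Rightarrow> 'a \<Rightarrow> 'a" where
  "grad K x = (THE g. GDERIV K x :> g)"

primrec C_k :: "nat \<Rightarrow> ('a::euclidean_space \<Rightarrow> real) \<Rightarrow> bool" where
  "C_k 0 f \<longleftrightarrow> continuous_on UNIV f"
| "C_k (Suc k) f \<longleftrightarrow>
     f differentiable_on UNIV \<and> (\<forall>h. C_k k (\<lambda>x. frechet_derivative f (at x) h))"

definition test_fun :: "('a::euclidean_space \<Rightarrow> real) \<Rightarrow> bool" where
  "test_fun \<phi> \<longleftrightarrow> (\<forall>k. C_k k \<phi>) \<and> compact (closure {x. \<phi> x \<noteq> 0})"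

definition L_infty :: "('a::euclidean_space \<Rightarrow> 'b::euclidean_space) \<Rightarrow> bool" where
  "L_infty f \<longleftrightarrow> f \<in> borel_measurable lebesgue \<and> (\<exists>C. AE x in lebesgue. norm (f x) \<le> C)"

(* g is the distributional derivative of f in direction b.  Only meaningful for locally
   integrable f and g, since a Bochner integral that does not exist is 0. *)
definition weak_dir_deriv ::
    "('a::euclidean_space \<Rightarrow> 'b::euclidean_space) \<Rightarrow> 'a \<Rightarrow> ('a \<Rightarrow> 'b) \<Rightarrow> bool" where
  "weak_dir_deriv f b g \<longleftrightarrow>
     (\<forall>\<phi>. test_fun \<phi> \<longrightarrow>
        (LINT x|lebesgue. frechet_derivative \<phi> (at x) b *\<^sub>R f x) =
        - (LINT x|lebesgue. \<phi> x *\<^sub>R g x))"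

definition W_1_infty :: "('a::euclidean_space \<Rightarrow> 'b::euclidean_space) \<Rightarrow> bool" where
  "W_1_infty f \<longleftrightarrow> L_infty f \<and> (\<forall>b\<in>Basis. \<exists>g. L_infty g \<and> weak_dir_deriv f b g)"

(* The N particles are indexed by a finite type 'n with CARD('n) = N, so that
   (real^'d)^'n plays the role of R^{Nd}. *)
definition velocity :: "(real^'d \<Rightarrow> real) \<Rightarrow> (real^'d)^'n \<Rightarrow> (real^'d)^'n" where
  "velocity K x =
     (\<chi> i. - ((1 / real CARD('n)) *\<^sub>R (\<Sum>j\<in>UNIV - {i}. grad K (x $ i - x $ j))))"

definition first_order_solution ::
    "(real^'d \<Rightarrow> real) \<Rightarrow> real \<Rightarrow> real \<Rightarrow> (real \<Rightarrow> (real^'d)^'n) \<Rightarrow> bool" where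
  "first_order_solution K t0 T x \<longleftrightarrow>
     (\<forall>t\<in>{t0..T}. \<forall>i.
        ((\<lambda>s. x s $ i) has_vector_derivative velocity K (x t) $ i) (at t within {t0..T}))"

definition second_order_solution ::
    "(real^'d \<Rightarrow> real) \<Rightarrow> real \<Rightarrow> real \<Rightarrow> real \<Rightarrow>
     (real \<Rightarrow> (real^'d)^'n) \<Rightarrow> (real \<Rightarrow> (real^'d)^'n) \<Rightarrow> bool" where
  "second_order_solution K \<epsilon> t0 T x v \<longleftrightarrow>
     (\<forall>t\<in>{t0..T}. \<forall>i.
        ((\<lambda>s. x s $ i) has_vector_derivative v t $ i) (at t within {t0..T}) \<and>
        (\<exists>a. ((\<lambda>s. v s $ i) has_vector_derivative a) (at t within {t0..T}) \<and>
             \<epsilon> *\<^sub>R a = - v t $ i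
               - (1 / real CARD('n)) *\<^sub>R (\<Sum>j\<in>UNIV - {i}. grad K (x t $ i - x t $ j))))"

end

theory Submission
  imports Defs "HOL-Computational_Algebra.Polynomial"
begin

text \<open>
The Sobolev hypothesis enters through its classical consequence: \<open>grad K\<close> is
bounded and Lipschitz at every point, so the field \<open>F = velocity K\<close> is bounded and Lipschitz.
Since a differentiable \<open>K\<close> fixes its gradient pointwise while the Sobolev condition is blind to
null sets, this needs an argument that never picks a representative. It goes through second
differences of \<open>K\<close>. Write \<open>D K = K(\<cdot> + s e) - K\<close>. For almost every \<open>x\<close>, \<open>D K(x)\<close> is the
integral of \<open>grad K \<bullet> e\<close> over the segment from \<open>x\<close> to \<open>x + s e\<close> (the fundamental theorem for the
gauge integral, which asks only for differentiability, together with Fubini's theorem: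
\<open>weighted_increment_bound\<close>). Testing the weak derivative against a smooth bump
\<open>\<phi>\<close> (\<open>weak_derivative_bound\<close>) and differentiating a translated average of \<open>D K\<close> under
the integral sign (\<open>bump_translation_bound\<close>) bounds the average of \<open>D K(\<cdot> - t b) - D K\<close>
against \<open>\<phi>\<close> by \<open>C t s |e|\<close> times the mass of \<open>\<phi>\<close>. As \<open>D K\<close> is continuous,
shrinking the bump makes this a pointwise bound; dividing by \<open>s\<close> and letting \<open>s\<close> tend to \<open>0\<close>
gives \<open>grad_lipschitz_in_direction\<close>.

For the limit \<open>\<epsilon> \<rightarrow> 0\<close>, the combination \<open>x\<^sub>\<epsilon> + \<epsilon> v\<^sub>\<epsilon>\<close> has derivative exactly \<open>F(x\<^sub>\<epsilon>)\<close>. It therefore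
satisfies the first-order equation up to the error \<open>\<epsilon> v\<^sub>\<epsilon>\<close>, and \<open>v\<^sub>\<epsilon>\<close> is bounded uniformly in \<open>\<epsilon>\<close>
because it relaxes towards the bounded field \<open>F\<close>. A Gronwall estimate gives
\<open>|x\<^sub>\<epsilon> - x| = O(\<epsilon>)\<close> uniformly in time (\<open>position_error\<close>). The velocity relaxes at rate \<open>1/\<epsilon>\<close> towards
\<open>F(x\<^sub>\<epsilon>)\<close>, which on a short interval ending at \<open>t\<close> is close to \<open>F(x(t))\<close>; the memory of the initial
velocity decays like \<open>exp(-\<tau>/\<epsilon>)\<close> over an interval of length \<open>\<tau> > 0\<close>, which yields
\<open>velocity_limit\<close> for \<open>t > t0\<close>. At \<open>t0\<close> itself the velocity equals \<open>v0\<close> for every \<open>\<epsilon>\<close>, so it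
converges to \<open>velocity K x0\<close> exactly when the two agree.
\<close>

section \<open>Smooth bump functions\<close>

lemma C_k_SucI:
  fixes f :: "'a::euclidean_space \<Rightarrow> real"
  assumes "\<And>x. (f has_derivative f' x) (at x)" and "\<And>h. C_k k (\<lambda>x. f' x h)"
  shows "C_k (Suc k) f"
proof -
  have "frechet_derivative f (at x) = f' x" for x
    using frechet_derivative_at[OF assms(1)] by simp
  then show ?thesis
    using assms by (auto simp: differentiable_on_def differentiable_def intro: has_derivative_at_withinI)
qed

lemma C_k_has_derivative:
  assumes "C_k (Suc k) f"
  shows "(f has_derivative frechet_derivative f (at x)) (at x)"
  using assms by (auto simp: differentiable_on_def frechet_derivative_works)

lemma C_k_Suc_imp: "C_k (Suc k) f \<Longrightarrow> C_k k f"
proof (induction k arbitrary: f)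
  case 0
  then show ?case by (simp add: differentiable_imp_continuous_on)
next
  case (Suc k)
  then show ?case by (metis C_k.simps(2))
qed

lemma C_k_const: "C_k k (\<lambda>x. c)"
proof (induction k arbitrary: c)
  case (Suc k)
  show ?case by (rule C_k_SucI[where f'="\<lambda>_ _. 0"]) (auto intro: Suc)
qed simp

lemma C_k_add: "C_k k f \<Longrightarrow> C_k k g \<Longrightarrow> C_k k (\<lambda>x. f x + g x)"
proof (induction k arbitrary: f g)
  case 0
  then show ?case by (simp add: continuous_on_add)
next
  case (Suc k)
  show ?case
    by (rule C_k_SucI[OF has_derivative_add[OF Suc.prems[THEN C_k_has_derivative]]])
       (use Suc in auto)
qed

lemma C_k_mult: "C_k k f \<Longrightarrow> C_k k g \<Longrightarrow> C_k k (\<lambda>x. f x * g x)"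
proof (induction k arbitrary: f g)
  case 0
  then show ?case by (simp add: continuous_on_mult)
next
  case (Suc k)
  have "C_k k (\<lambda>x. frechet_derivative f (at x) h)" "C_k k (\<lambda>x. frechet_derivative g (at x) h)" for h
    using Suc.prems by auto
  moreover have "C_k k f" "C_k k g"
    using Suc.prems by (auto intro: C_k_Suc_imp simp del: C_k.simps)
  ultimately show ?case
    by (intro C_k_SucI[OF has_derivative_mult[OF Suc.prems[THEN C_k_has_derivative]]] C_k_add Suc.IH)
qed

lemma C_k_prod:
  assumes "finite I" "\<And>i. i \<in> I \<Longrightarrow> C_k k (f i)"
  shows "C_k k (\<lambda>x. \<Prod>i\<in>I. f i x)"
  using assms by (induction I) (auto intro: C_k_const C_k_mult)

text \<open>The functions \<open>P(1/u) exp(-1/u)\<close>, extended by zero to \<open>u \<le> 0\<close>, with \<open>P\<close> ranging over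
the polynomials: a family that contains the standard flat function (\<open>P = 1\<close>) and is closed
under differentiation.\<close>
definition flat :: "real poly \<Rightarrow> real \<Rightarrow> real" where
  "flat P u = (if u > 0 then poly P (1 / u) * exp (- 1 / u) else 0)"

text \<open>Substituting \<open>w = 1/u\<close> turns this into the decay of \<open>P(w) exp(-w)\<close> at infinity.\<close>
lemma flat_tendsto_0: "(flat P \<longlongrightarrow> 0) (at 0)"
proof -
  have "((\<lambda>w. \<Sum>i\<le>degree P. coeff P i * (w ^ i / exp w)) \<longlongrightarrow> (\<Sum>i\<le>degree P. coeff P i * 0)) at_top"
    by (intro tendsto_intros tendsto_power_div_exp_0)
  then have "((\<lambda>w. poly P w * exp (- w)) \<longlongrightarrow> 0) at_top"
    by (simp add: poly_altdef sum_distrib_right exp_minus field_simps sum_divide_distrib)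
  then have "((\<lambda>u. poly P (inverse u) * exp (- inverse u)) \<longlongrightarrow> 0) (at_right 0)"
    by (rule filterlim_compose) (rule filterlim_inverse_at_top_right)
  then have "(flat P \<longlongrightarrow> 0) (at_right 0)"
    by (rule Lim_transform_eventually)
       (auto simp: flat_def eventually_at_filter field_simps)
  moreover have "(flat P \<longlongrightarrow> 0) (at_left 0)"
    by (rule tendsto_eventually) (auto simp: flat_def eventually_at_filter)
  ultimately show ?thesis
    by (simp add: filterlim_at_split)
qed

lemma DERIV_flat: "(flat P has_real_derivative flat ([:0, 0, 1:] * (P - pderiv P)) u) (at u)"
proof -
  consider "u > 0" | "u < 0" | "u = 0" by linarith
  then show ?thesis
  proof cases
    case 1
    have "((\<lambda>u. poly P (1 / u) * exp (- 1 / u)) has_real_derivative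
        flat ([:0, 0, 1:] * (P - pderiv P)) u) (at u)"
      using 1 by (auto intro!: derivative_eq_intros DERIV_chain2[OF poly_DERIV]
        simp: flat_def field_simps power2_eq_square)
    moreover have "\<forall>\<^sub>F y in nhds u. flat P y = poly P (1 / y) * exp (- 1 / y)"
      using eventually_nhds_in_open[of "{0<..}" u] 1 by (auto simp: flat_def elim: eventually_mono)
    ultimately show ?thesis by (subst DERIV_cong_ev) auto
  next
    case 2
    have "((\<lambda>u. 0) has_real_derivative flat ([:0, 0, 1:] * (P - pderiv P)) u) (at u)"
      using 2 by (auto simp: flat_def)
    moreover have "\<forall>\<^sub>F y in nhds u. flat P y = 0"
      using eventually_nhds_in_open[of "{..<0}" u] 2 by (auto simp: flat_def elim: eventually_mono)
    ultimately show ?thesis by (subst DERIV_cong_ev) auto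
  next
    case 3
    \<comment> \<open>The difference quotient at the origin is again of the same form.\<close>
    have "(flat P h - flat P 0) / h = flat (pCons 0 P) h" for h
      by (auto simp: flat_def)
    then show ?thesis
      using flat_tendsto_0[of "pCons 0 P"] 3 by (simp add: DERIV_def flat_def[of _ 0])
  qed
qed

text \<open>Smoothness follows by induction on the order because the derivative stays in the family.\<close>
lemma C_k_flat:
  fixes w :: "'a::euclidean_space"
  shows "C_k k (\<lambda>x. flat P (a + w \<bullet> x))"
proof (induction k arbitrary: P)
  case 0
  have "continuous_on UNIV (flat P)"
    by (intro continuous_at_imp_continuous_on ballI) (rule DERIV_isCont[OF DERIV_flat])
  then show ?case
    by (auto intro!: continuous_on_compose2[of UNIV "flat P"] continuous_intros)
next
  case (Suc k)
  let ?Q = "[:0, 0, 1:] * (P - pderiv P)"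
  have "((\<lambda>x. flat P (a + w \<bullet> x)) has_derivative (\<lambda>h. flat ?Q (a + w \<bullet> x) * (w \<bullet> h))) (at x)" for x
  proof -
    have "((\<lambda>x. a + w \<bullet> x) has_derivative (\<lambda>h. w \<bullet> h)) (at x)"
      by (auto intro!: derivative_eq_intros)
    from has_derivative_compose[OF this DERIV_flat[unfolded has_field_derivative_def]]
    show ?thesis by simp
  qed
  then show ?case
    by (rule C_k_SucI) (intro C_k_mult Suc C_k_const)
qed

text \<open>A product of one-dimensional bumps rather than a function of the norm, so that smoothness
needs only closure of \<open>C_k\<close> under products and affine arguments. The support is the cube of
half side \<open>d\<close> around \<open>c\<close>, which lies in the ball of radius \<open>d\<close> times the dimension.\<close>
definition bump :: "'a::euclidean_space \<Rightarrow> real \<Rightarrow> 'a \<Rightarrow> real" where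
  "bump c d x = (\<Prod>i\<in>Basis. flat 1 (d + (x - c) \<bullet> i) * flat 1 (d - (x - c) \<bullet> i))"

lemma bump_nonneg: "bump c d x \<ge> 0"
  by (auto simp: bump_def flat_def intro!: prod_nonneg)

lemma bump_center_pos: "d > 0 \<Longrightarrow> bump c d c > 0"
  by (auto simp: bump_def flat_def intro!: prod_pos)

lemma bump_translate: "bump c d (x + a) = bump (c - a) d x"
  by (simp add: bump_def algebra_simps)

lemma bump_support:
  fixes x :: "'a::euclidean_space" and d :: real
  assumes "bump c d x \<noteq> 0"
  shows "norm (x - c) \<le> DIM('a) * d"
proof -
  have *: "\<bar>(x - c) \<bullet> i\<bar> \<le> d" if "i \<in> Basis" for i
  proof -
    have "flat 1 (d + (x - c) \<bullet> i) * flat 1 (d - (x - c) \<bullet> i) \<noteq> 0"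
      using assms that by (auto simp: bump_def)
    then show ?thesis by (auto simp: flat_def split: if_splits)
  qed
  have "norm (x - c) \<le> (\<Sum>i\<in>Basis. \<bar>(x - c) \<bullet> i\<bar>)" by (rule norm_le_l1)
  also have "\<dots> \<le> (\<Sum>i\<in>(Basis::'a set). d)" by (intro sum_mono *)
  finally show ?thesis by simp
qed

lemma C_k_bump: "C_k k (bump c d)"
proof -
  have "C_k k (\<lambda>x. flat 1 (d + (x - c) \<bullet> i) * flat 1 (d - (x - c) \<bullet> i))" for i
    using C_k_mult[OF C_k_flat[of k 1 "d - c \<bullet> i" i] C_k_flat[of k 1 "d + c \<bullet> i" "- i"]]
    by (simp add: algebra_simps inner_commute)
  then show ?thesis unfolding bump_def[abs_def] by (intro C_k_prod) auto
qed

lemma bump_support_cball: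
  fixes x :: "'a::euclidean_space" and d :: real
  shows "bump c d x \<noteq> 0 \<Longrightarrow> x \<in> cball c (DIM('a) * d)"
  using bump_support[of c d x] by (simp add: dist_norm norm_minus_commute)

lemma test_fun_bump: "test_fun (bump (c::'a::euclidean_space) d)"
proof -
  have "{x. bump c d x \<noteq> 0} \<subseteq> cball c (DIM('a) * d)"
    using bump_support_cball by blast
  then have "bounded {x. bump c d x \<noteq> 0}" by (rule bounded_subset[OF bounded_cball])
  then show ?thesis by (auto simp: test_fun_def C_k_bump)
qed

section \<open>The gradient along lines\<close>

text \<open>The derivative of a real function on a Euclidean space is a linear functional, hence the inner
product with a unique vector; so the definite description in \<open>grad\<close> denotes that vector.\<close>
lemma has_derivative_grad:
  fixes K :: "'a::euclidean_space \<Rightarrow> real"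
  assumes "K differentiable_on UNIV"
  shows "(K has_derivative (\<lambda>h. h \<bullet> grad K x)) (at x)"
proof -
  obtain K' where K': "(K has_derivative K') (at x)"
    using assms by (auto simp: differentiable_on_def differentiable_def)
  have lin: "linear K'" using K' by (simp add: has_derivative_linear)
  define g where "g = (\<Sum>b\<in>Basis. K' b *\<^sub>R b)"
  have "K' h = h \<bullet> g" for h
  proof -
    have "K' h = K' (\<Sum>b\<in>Basis. (h \<bullet> b) *\<^sub>R b)" by (simp add: euclidean_representation)
    also have "\<dots> = (\<Sum>b\<in>Basis. (h \<bullet> b) * K' b)"
      by (simp add: linear_sum[OF lin] linear_scale[OF lin])
    also have "\<dots> = h \<bullet> g" by (simp add: g_def inner_sum_right mult.commute)
    finally show ?thesis .
  qed
  then have "K' = (\<lambda>h. h \<bullet> g)" by blast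
  then have g: "GDERIV K x :> g" using K' by (simp add: gderiv_def)
  have "g' = g" if "GDERIV K x :> g'" for g'
  proof -
    have "(\<lambda>h. h \<bullet> g') = (\<lambda>h. h \<bullet> g)"
      by (rule has_derivative_unique[OF that[unfolded gderiv_def] g[unfolded gderiv_def]])
    then have "(g' - g) \<bullet> g' = (g' - g) \<bullet> g" by (rule fun_cong)
    then have "(g' - g) \<bullet> (g' - g) = 0" by (simp add: inner_diff_right)
    then show ?thesis by simp
  qed
  then have "grad K x = g" unfolding grad_def using g by (intro the_equality)
  then show ?thesis using g by (simp add: gderiv_def)
qed

lemma has_vector_derivative_along_line:
  fixes K :: "'a::euclidean_space \<Rightarrow> real"
  assumes "K differentiable_on UNIV"
  shows "((\<lambda>r. K (x + r *\<^sub>R e)) has_vector_derivative grad K (x + r *\<^sub>R e) \<bullet> e) (at r within S)"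
proof -
  have "((\<lambda>r. x + r *\<^sub>R e) has_derivative (\<lambda>h. h *\<^sub>R e)) (at r within S)"
    by (auto intro!: derivative_eq_intros)
  from has_derivative_compose[OF this has_derivative_grad[OF assms]]
  show ?thesis by (simp add: has_vector_derivative_def inner_commute)
qed

text \<open>A limit of difference quotients of a continuous function. Borel measurability, and not only the
Lebesgue measurability contained in \<open>L_infty\<close>, is what Fubini's theorem on the product of two
Borel measures asks for.\<close>
lemma borel_measurable_grad_inner:
  fixes K :: "'a::euclidean_space \<Rightarrow> real"
  assumes "K differentiable_on UNIV"
  shows "(\<lambda>x. grad K x \<bullet> e) \<in> borel_measurable borel"
proof (rule borel_measurable_LIMSEQ_real)
  have "continuous_on UNIV K" using assms by (rule differentiable_imp_continuous_on)
  then have [measurable]: "K \<in> borel_measurable borel" by (rule borel_measurable_continuous_onI)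
  show "(\<lambda>x. (K (x + (1 / real (Suc n)) *\<^sub>R e) - K x) / (1 / real (Suc n))) \<in> borel_measurable borel" for n
    by measurable
  fix x
  have "((\<lambda>r. (K (x + r *\<^sub>R e) - K x) / r) \<longlongrightarrow> grad K x \<bullet> e) (at 0)"
    using has_vector_derivative_along_line[OF assms, of x e 0 UNIV]
    by (simp add: has_real_derivative_iff_has_vector_derivative[symmetric] DERIV_def)
  moreover have "filterlim (\<lambda>n. 1 / real (Suc n)) (at 0) sequentially"
    using LIMSEQ_inverse_real_of_nat by (auto simp: filterlim_at inverse_eq_divide)
  ultimately show "(\<lambda>n. (K (x + (1 / real (Suc n)) *\<^sub>R e) - K x) / (1 / real (Suc n))) \<longlonglongrightarrow> grad K x \<bullet> e"
    by (rule filterlim_compose)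
qed

lemma lborel_integral_translate:
  fixes f :: "'a::euclidean_space \<Rightarrow> real"
  assumes "f \<in> borel_measurable borel"
  shows "(LINT x|lborel. f (x + a)) = (LINT x|lborel. f x)"
proof -
  have "(LINT x|lborel. f x) = (LINT x|distr lborel borel ((+) a). f x)"
    by (simp add: lborel_distr_plus)
  also have "\<dots> = (LINT x|lborel. f (a + x))"
    by (rule integral_distr) (use assms in auto)
  finally show ?thesis by (simp add: add.commute)
qed

lemma AE_lborel_translate:
  fixes a :: "'a::euclidean_space"
  assumes "AE x in lborel. P x" "{x. P x} \<in> sets borel"
  shows "AE x in lborel. P (x + a)"
proof -
  have "AE x in distr lborel borel ((+) a). P x"
    using assms(1) by (subst lborel_distr_plus)
  then show ?thesis
    using assms(2) by (subst (asm) AE_distr_iff) (auto simp: add.commute)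
qed

lemma integrable_bounded_support:
  fixes f :: "'a::euclidean_space \<Rightarrow> 'b::{banach, second_countable_topology}"
  assumes "f \<in> borel_measurable lborel" "bounded S" "S \<in> sets borel"
    "AE x in lborel. norm (f x) \<le> B" "\<And>x. x \<notin> S \<Longrightarrow> f x = 0"
  shows "integrable lborel f"
proof (rule integrableI_bounded_set[of S _ _ B])
  show "emeasure lborel S < \<infinity>" using assms(2) by (rule emeasure_bounded_finite)
qed (use assms in auto)

lemma continuous_compact_support_bounded:
  fixes \<psi> :: "'a::euclidean_space \<Rightarrow> real"
  assumes "continuous_on UNIV \<psi>" "compact S" "\<And>x. x \<notin> S \<Longrightarrow> \<psi> x = 0"
  obtains B where "B \<ge> 0" "\<And>x. \<bar>\<psi> x\<bar> \<le> B"
proof -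
  have "compact (\<psi> ` S)"
    by (rule compact_continuous_image[OF continuous_on_subset[OF assms(1)] assms(2)]) simp
  then obtain B where "\<forall>x\<in>\<psi> ` S. norm x \<le> B" using compact_imp_bounded bounded_iff by blast
  then have "\<bar>\<psi> x\<bar> \<le> max B 0" for x
    using assms(3)[of x] by (cases "x \<in> S") (auto simp: max_def)
  then show ?thesis by (intro that[of "max B 0"]) auto
qed

text \<open>Write the increment \<open>K (x + s *\<^sub>R e) - K x\<close> as the integral of \<open>q\<close> along a segment, then
exchange the order of integration. Because \<open>q\<close> is bounded only almost everywhere, it is replaced
by a truncation \<open>p\<close>, for which everything is integrable. A null set meets
almost every line in direction \<open>e\<close> in a null set, so on almost every segment \<open>p\<close> and \<open>q\<close> have
the same integral.\<close>
lemma weighted_increment_bound: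
  fixes K q \<psi> :: "'a::euclidean_space \<Rightarrow> real"
  assumes contK: "continuous_on UNIV K" and q[measurable]: "q \<in> borel_measurable borel"
    and der: "\<And>x r. ((\<lambda>r. K (x + r *\<^sub>R e)) has_vector_derivative q (x + r *\<^sub>R e)) (at r within {0..s})"
    and q_bound: "AE x in lborel. \<bar>q x\<bar> \<le> M"
    and \<psi>: "continuous_on UNIV \<psi>" "compact S" "\<And>x. x \<notin> S \<Longrightarrow> \<psi> x = 0"
    and "s \<ge> 0" and A: "\<And>r. \<bar>LINT x|lborel. \<psi> x * q (x + r *\<^sub>R e)\<bar> \<le> A"
  shows "\<bar>LINT x|lborel. \<psi> x * (K (x + s *\<^sub>R e) - K x)\<bar> \<le> A * s"
proof -
  have [measurable]: "\<psi> \<in> borel_measurable borel" "K \<in> borel_measurable borel"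
    using \<psi> contK by (auto intro: borel_measurable_continuous_onI)
  obtain B where B: "B \<ge> 0" "\<And>x. \<bar>\<psi> x\<bar> \<le> B"
    using continuous_compact_support_bounded[OF \<psi>] by blast
  define M' where "M' = max M 0"
  define p where "p x = (if \<bar>q x\<bar> \<le> M' then q x else 0)" for x
  have M': "M' \<ge> 0" by (simp add: M'_def)
  have [measurable]: "p \<in> borel_measurable borel" unfolding p_def[abs_def] by measurable
  have p_bound: "\<bar>p x\<bar> \<le> M'" for x using M' by (simp add: p_def)
  define H where "H x r = \<psi> x * (indicator {0..s} r * p (x + r *\<^sub>R e))" for x r
  have "\<bar>H x r\<bar> \<le> B * M'" for x r
    using B p_bound M' by (auto simp: H_def abs_mult indicator_def intro!: mult_mono)
  then have H_bound: "AE z in lborel. norm (case_prod H z) \<le> B * M'" by auto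
  have "integrable lborel (case_prod H)"
  proof (rule integrable_bounded_support[OF _ _ _ H_bound, where S="S \<times> {0..s}"])
    show "case_prod H \<in> borel_measurable lborel"
      unfolding H_def by (simp flip: lborel_prod)
    show "case_prod H z = 0" if "z \<notin> S \<times> {0..s}" for z
      using that \<psi>(3) by (cases z) (auto simp: H_def indicator_def)
  qed (use \<psi> in \<open>auto simp: bounded_Times compact_imp_bounded compact_imp_closed closed_Times borel_closed\<close>)
  then have "integrable (lborel \<Otimes>\<^sub>M lborel) (case_prod H)" by (simp add: lborel_prod)
  note fubini = lborel_pair.Fubini_integral[OF this]
  have AEr: "AE x in lborel. \<bar>q (x + r *\<^sub>R e)\<bar> \<le> M'" for r
  proof (rule AE_lborel_translate)
    show "AE x in lborel. \<bar>q x\<bar> \<le> M'" using q_bound by (auto simp: M'_def)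
  qed measurable
  \<comment> \<open>For fixed \<open>r\<close> the truncation is invisible by translation invariance; for almost every
    \<open>x\<close> it is invisible on the segment by Fubini's theorem for null sets.\<close>
  have inner_x: "(LINT x|lborel. H x r) = indicator {0..s} r * (LINT x|lborel. \<psi> x * q (x + r *\<^sub>R e))" for r
  proof -
    have "(LINT x|lborel. H x r) = (LINT x|lborel. indicator {0..s} r * (\<psi> x * p (x + r *\<^sub>R e)))"
      by (simp add: H_def mult_ac)
    also have "\<dots> = indicator {0..s} r * (LINT x|lborel. \<psi> x * p (x + r *\<^sub>R e))"
      by (rule integral_mult_right_zero)
    also have "(LINT x|lborel. \<psi> x * p (x + r *\<^sub>R e)) = (LINT x|lborel. \<psi> x * q (x + r *\<^sub>R e))"
      by (rule integral_cong_AE) (use AEr[of r] in \<open>auto simp: p_def\<close>)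
    finally show ?thesis .
  qed
  have "AE x in lborel. AE r in lborel. \<bar>q (x + r *\<^sub>R e)\<bar> \<le> M'"
    by (subst lborel_pair.AE_commute) (measurable, use AEr in auto)
  then have inner_r: "AE x in lborel. (LINT r|lborel. H x r) = \<psi> x * (K (x + s *\<^sub>R e) - K x)"
  proof eventually_elim
    case (elim x)
    \<comment> \<open>The gauge integral of a derivative always exists; the bounded \<open>p\<close> then turns it into a
      Lebesgue integral.\<close>
    have "((\<lambda>r. q (x + r *\<^sub>R e)) has_integral (K (x + s *\<^sub>R e) - K (x + 0 *\<^sub>R e))) {0..s}"
      using der \<open>s \<ge> 0\<close> by (intro fundamental_theorem_of_calculus) auto
    then have 1: "((\<lambda>r. p (x + r *\<^sub>R e)) has_integral (K (x + s *\<^sub>R e) - K x)) {0..s}"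
      using elim by (subst has_integral_AE[where g="\<lambda>r. q (x + r *\<^sub>R e)"]) (auto simp: p_def)
    have "set_integrable lborel {0..s} (\<lambda>r. p (x + r *\<^sub>R e))"
      unfolding set_integrable_def
      by (intro integrable_bounded_support[where S="{0..s}" and B=M'])
         (use p_bound M' in \<open>auto simp: indicator_def\<close>)
    then have "((\<lambda>r. p (x + r *\<^sub>R e)) has_integral (LINT r:{0..s}|lborel. p (x + r *\<^sub>R e))) {0..s}"
      using set_borel_integral_eq_integral by (metis integrable_integral)
    with 1 have "(LINT r:{0..s}|lborel. p (x + r *\<^sub>R e)) = K (x + s *\<^sub>R e) - K x"
      using has_integral_unique by blast
    then show ?case by (simp add: H_def set_lebesgue_integral_def)
  qed
  have "(LINT x|lborel. \<psi> x * (K (x + s *\<^sub>R e) - K x)) = (LINT x|lborel. LINT r|lborel. H x r)"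
    by (rule integral_cong_AE) (use inner_r in \<open>auto simp: H_def\<close>)
  also have "\<dots> = (LINT r|lborel. indicator {0..s} r * (LINT x|lborel. \<psi> x * q (x + r *\<^sub>R e)))"
    by (simp add: fubini[symmetric] inner_x)
  also have "\<bar>\<dots>\<bar> \<le> (LINT r|lborel. indicator {0..s} r * A)"
  proof (rule integral_abs_bound_integral)
    show "integrable lborel (\<lambda>r. indicator {0..s} r * (LINT x|lborel. \<psi> x * q (x + r *\<^sub>R e)))"
      by (rule integrable_bounded_support[where S="{0..s}" and B=A])
         (use A order_trans[OF abs_ge_zero A] in \<open>auto simp: indicator_def\<close>)
    show "integrable lborel (\<lambda>r. indicator {0..s} r * A)"
      by (intro integrable_mult_left integrable_real_indicator) (auto simp: emeasure_lborel_Icc_eq)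
  qed (use A in \<open>auto simp: indicator_def\<close>)
  also have "\<dots> = A * s" using \<open>s \<ge> 0\<close> by simp
  finally show ?thesis .
qed

section \<open>From weak derivatives to a Lipschitz gradient\<close>

abbreviation dbump :: "'a::euclidean_space \<Rightarrow> 'a \<Rightarrow> real \<Rightarrow> 'a \<Rightarrow> real" where
  "dbump b c d x \<equiv> frechet_derivative (bump c d) (at x) b"

lemma continuous_bump: "continuous_on UNIV (bump c d)"
  using C_k_bump[of 0] by simp

lemma bump_has_derivative: "(bump c d has_derivative frechet_derivative (bump c d) (at x)) (at x)"
  using C_k_has_derivative[OF C_k_bump] .

lemma continuous_dbump: "continuous_on UNIV (dbump b c d)"
  using C_k_bump[of "Suc 0" c d] by simp

lemma dbump_translate: "dbump b c d (x + a) = dbump b (c - a) d x"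
proof -
  have "((\<lambda>x. x + a) has_derivative (\<lambda>h. h)) (at x)" by (auto intro!: derivative_eq_intros)
  from has_derivative_compose[OF this bump_has_derivative]
  have "((\<lambda>x. bump c d (x + a)) has_derivative frechet_derivative (bump c d) (at (x + a))) (at x)" .
  then have "(bump (c - a) d has_derivative frechet_derivative (bump c d) (at (x + a))) (at x)"
    by (simp add: bump_translate)
  from frechet_derivative_at[OF this] show ?thesis by simp
qed

lemma bump_zero_outside:
  fixes c :: "'a::euclidean_space" and d :: real
  shows "x \<notin> cball c (DIM('a) * d) \<Longrightarrow> bump c d x = 0"
  using bump_support_cball by blast

lemma dbump_zero_outside:
  fixes c :: "'a::euclidean_space" and d :: real
  assumes "x \<notin> cball c (DIM('a) * d)"
  shows "dbump b c d x = 0"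
proof -
  have "(bump c d has_derivative (\<lambda>h. 0)) (at x)"
  proof (rule has_derivative_transform_within_open[OF has_derivative_const])
    show "open (- cball c (DIM('a) * d))" by auto
    show "x \<in> - cball c (DIM('a) * d)" using assms by auto
    show "0 = bump c d y" if "y \<in> - cball c (DIM('a) * d)" for y
      using that by (simp add: bump_zero_outside)
  qed
  from frechet_derivative_at[OF this] show ?thesis by metis
qed

lemma integrable_compact_support:
  fixes \<psi> :: "'a::euclidean_space \<Rightarrow> real"
  assumes "continuous_on UNIV \<psi>" "compact S" "\<And>x. x \<notin> S \<Longrightarrow> \<psi> x = 0"
  shows "integrable lborel \<psi>"
proof -
  obtain B where "B \<ge> 0" "\<And>x. \<bar>\<psi> x\<bar> \<le> B" using continuous_compact_support_bounded[OF assms] by blast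
  then show ?thesis
    using assms by (intro integrable_bounded_support[of \<psi> S B])
      (auto intro: borel_measurable_continuous_onI compact_imp_bounded borel_closed compact_imp_closed)
qed

lemma integrable_bump: "integrable lborel (bump c d)"
  using continuous_bump compact_cball bump_zero_outside by (rule integrable_compact_support)

lemma bump_integral_translate: "(LINT x|lborel. bump (c - a) d x) = (LINT x|lborel. bump c d x)"
  using lborel_integral_translate[of "bump c d" a]
  by (simp add: bump_translate borel_measurable_continuous_onI continuous_bump)

text \<open>A continuous nonnegative function with zero integral vanishes almost everywhere, but a nonempty
open set is not negligible.\<close>
lemma bump_integral_pos:
  assumes "d > 0"
  shows "(LINT x|lborel. bump c d x) > 0"
proof (rule ccontr)
  assume "\<not> ?thesis"
  moreover have "(LINT x|lborel. bump c d x) \<ge> 0" by (simp add: bump_nonneg)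
  ultimately have "(LINT x|lborel. bump c d x) = 0" by linarith
  then have "AE x in lborel. bump c d x = 0"
    by (subst (asm) integral_nonneg_eq_0_iff_AE) (auto simp: integrable_bump bump_nonneg)
  then have "AE x in lebesgue. x \<notin> {x. bump c d x \<noteq> 0}" by (simp add: AE_completion)
  moreover have op: "open {x. bump c d x \<noteq> 0}"
    using continuous_bump by (intro open_Collect_neq continuous_on_const)
  ultimately have "{x. bump c d x \<noteq> 0} \<in> null_sets lebesgue"
    by (subst AE_iff_null_sets) auto
  then have "negligible {x. bump c d x \<noteq> 0}" by (simp add: negligible_iff_null_sets)
  moreover have "c \<in> {x. bump c d x \<noteq> 0}" using bump_center_pos[OF assms, of c] by simp
  ultimately show False using open_not_negligible[OF op] by blast
qed

text \<open>The definition of the weak derivative trades the derivative of the bump for \<open>g\<close>, which is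
bounded. Only components \<open>f x \<bullet> e\<close> are estimated, since they are what the increments of \<open>K\<close> in
direction \<open>e\<close> integrate.\<close>
lemma weak_derivative_bound:
  fixes f :: "'a::euclidean_space \<Rightarrow> 'a"
  assumes f: "L_infty f" and meas: "(\<lambda>x. f x \<bullet> e) \<in> borel_measurable borel"
    and g: "g \<in> borel_measurable lebesgue" "AE x in lebesgue. norm (g x) \<le> C" "weak_dir_deriv f b g"
  shows "\<bar>LINT x|lborel. dbump b c d x * (f x \<bullet> e)\<bar> \<le> C * norm e * (LINT x|lborel. bump c d x)"
proof -
  obtain C1 where C1: "f \<in> borel_measurable lebesgue" "AE x in lebesgue. norm (f x) \<le> C1"
    using f by (auto simp: L_infty_def)
  have [measurable]: "dbump b c d \<in> borel_measurable borel" "bump c d \<in> borel_measurable borel"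
    by (intro borel_measurable_continuous_onI continuous_dbump continuous_bump)+
  have leb: "integrable lebesgue (dbump b c d)" "integrable lebesgue (bump c d)"
    using integrable_compact_support[OF continuous_dbump compact_cball dbump_zero_outside] integrable_bump
    by (auto simp: integrable_completion)
  have bl [measurable]: "dbump b c d \<in> borel_measurable lebesgue" "bump c d \<in> borel_measurable lebesgue"
    by (auto intro: measurable_completion)
  have int_f: "integrable lebesgue (\<lambda>x. dbump b c d x *\<^sub>R f x)"
  proof (rule Bochner_Integration.integrable_bound)
    show "integrable lebesgue (\<lambda>x. C1 * dbump b c d x)" using leb by simp
    show "AE x in lebesgue. norm (dbump b c d x *\<^sub>R f x) \<le> norm (C1 * dbump b c d x)"
      using C1(2) by eventually_elim
        (simp add: abs_mult, smt (verit) mult_left_mono mult.commute norm_ge_zero abs_ge_zero)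
  qed (use bl C1 in measurable)
  have g_le: "AE x in lebesgue. norm (bump c d x *\<^sub>R g x) \<le> C * bump c d x"
    using g(2) by eventually_elim (simp add: bump_nonneg mult.commute mult_right_mono)
  have "(LINT x|lborel. dbump b c d x * (f x \<bullet> e)) = (LINT x|lebesgue. (dbump b c d x *\<^sub>R f x) \<bullet> e)"
    using meas by (subst integral_completion) auto
  also have "\<dots> = (LINT x|lebesgue. dbump b c d x *\<^sub>R f x) \<bullet> e"
    by (rule integral_inner_left) (rule int_f)
  also have "\<dots> = - (LINT x|lebesgue. bump c d x *\<^sub>R g x) \<bullet> e"
    using g(3) test_fun_bump[of c d] unfolding weak_dir_deriv_def by simp
  finally have "\<bar>LINT x|lborel. dbump b c d x * (f x \<bullet> e)\<bar> \<le> norm (LINT x|lebesgue. bump c d x *\<^sub>R g x) * norm e"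
    by (simp add: Cauchy_Schwarz_ineq2)
  also have "norm (LINT x|lebesgue. bump c d x *\<^sub>R g x) \<le> (LINT x|lebesgue. norm (bump c d x *\<^sub>R g x))"
    by (rule integral_norm_bound)
  also have "\<dots> \<le> (LINT x|lebesgue. C * bump c d x)"
  proof (rule integral_mono_AE)
    show C: "integrable lebesgue (\<lambda>x. C * bump c d x)" using leb by simp
    have "integrable lebesgue (\<lambda>x. bump c d x *\<^sub>R g x)"
    proof (rule Bochner_Integration.integrable_bound[OF C])
      show "(\<lambda>x. bump c d x *\<^sub>R g x) \<in> borel_measurable lebesgue"
        using bl g(1) by measurable
      show "AE x in lebesgue. norm (bump c d x *\<^sub>R g x) \<le> norm (C * bump c d x)"
        using g_le by eventually_elim simp
    qed
    then show "integrable lebesgue (\<lambda>x. norm (bump c d x *\<^sub>R g x))" by (rule integrable_norm)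
  qed (rule g_le)
  also have "\<dots> = C * (LINT x|lborel. bump c d x)"
    by (simp add: integral_completion)
  finally show ?thesis by (simp add: mult_right_mono mult_ac)
qed

lemma lint_eq_integral_cbox:
  fixes \<psi> :: "'a::euclidean_space \<Rightarrow> real"
  assumes "continuous_on UNIV \<psi>" "\<And>x. x \<notin> cbox p q \<Longrightarrow> \<psi> x = 0"
  shows "(LINT x|lborel. \<psi> x) = integral (cbox p q) \<psi>"
proof -
  have "integrable lborel \<psi>" using assms by (rule integrable_compact_support[OF _ compact_cbox])
  then have "(\<psi> has_integral (LINT x|lborel. \<psi> x)) UNIV" by (rule has_integral_integral_lborel)
  moreover have "(\<lambda>x. if x \<in> cbox p q then \<psi> x else 0) = \<psi>" using assms(2) by auto
  ultimately have "(\<psi> has_integral (LINT x|lborel. \<psi> x)) (cbox p q)"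
    using has_integral_restrict_UNIV[of "cbox p q" \<psi>] by simp
  then show ?thesis by (simp add: integral_unique)
qed

text \<open>Averages against shrinking bumps recover the value of a continuous function at the centre.\<close>
lemma bump_average_bound:
  fixes w :: "'a::euclidean_space \<Rightarrow> real"
  assumes w: "continuous_on UNIV w"
    and avg: "\<And>d. d > 0 \<Longrightarrow> (LINT x|lborel. bump y d x * w x) \<le> \<kappa> * (LINT x|lborel. bump y d x)"
  shows "w y \<le> \<kappa>"
proof (rule ccontr)
  assume "\<not> w y \<le> \<kappa>"
  then obtain \<kappa>' where \<kappa>': "\<kappa> < \<kappa>'" "\<kappa>' < w y" using dense by (metis not_le)
  have "open {x. \<kappa>' < w x}" using w by (intro open_Collect_less continuous_on_const)
  then obtain \<rho> where \<rho>: "\<rho> > 0" "cball y \<rho> \<subseteq> {x. \<kappa>' < w x}"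
    using \<kappa>' by (auto simp: open_contains_cball)
  define d where "d = \<rho> / DIM('a)"
  have d: "d > 0" "DIM('a) * d = \<rho>" using \<rho> by (auto simp: d_def)
  have "\<kappa>' * (LINT x|lborel. bump y d x) = (LINT x|lborel. bump y d x * \<kappa>')"
    by (simp add: mult.commute)
  also have "\<dots> \<le> (LINT x|lborel. bump y d x * w x)"
  proof (rule integral_mono)
    show "integrable lborel (\<lambda>x. bump y d x * \<kappa>')" by (simp add: integrable_bump)
    show "integrable lborel (\<lambda>x. bump y d x * w x)"
      by (rule integrable_compact_support[OF _ compact_cball[of y "DIM('a) * d"]])
         (auto intro!: continuous_intros continuous_bump w simp: bump_zero_outside)
    show "bump y d x * \<kappa>' \<le> bump y d x * w x" for x
    proof (cases "x \<in> cball y \<rho>")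
      case True
      then show ?thesis using \<rho> by (intro mult_left_mono) (auto simp: bump_nonneg)
    next
      case False
      then have "bump y d x = 0" using d by (intro bump_zero_outside) simp
      then show ?thesis by simp
    qed
  qed
  also have "\<dots> \<le> \<kappa> * (LINT x|lborel. bump y d x)" by (rule avg) (rule d)
  finally show False using \<kappa>' bump_integral_pos[OF d(1), of y] by simp
qed

text \<open>The mean value theorem for the translated average as a function of the shift. All translates
for shifts in \<open>{0..t}\<close> are supported in one box, so that differentiating under the integral sign
takes place over a fixed compact domain.\<close>
lemma bump_translation_bound:
  fixes u :: "'a::euclidean_space \<Rightarrow> real"
  assumes u: "continuous_on UNIV u" and "t \<ge> 0"
    and der: "\<And>\<tau>. \<bar>LINT x|lborel. dbump b c d (x + \<tau> *\<^sub>R b) * u x\<bar> \<le> A"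
  shows "\<bar>(LINT x|lborel. bump c d (x + t *\<^sub>R b) * u x) - (LINT x|lborel. bump c d x * u x)\<bar> \<le> A * t"
proof -
  define S where "S = (\<Union>\<tau>\<in>{0..t}. cball (c - \<tau> *\<^sub>R b) (DIM('a) * d))"
  have "bounded ((\<lambda>(\<tau>, y). y - \<tau> *\<^sub>R b) ` ({0..t} \<times> cball c (DIM('a) * d)))"
    by (intro compact_imp_bounded compact_continuous_image compact_Times)
       (auto intro!: continuous_intros simp: split_beta)
  moreover have "S \<subseteq> (\<lambda>(\<tau>, y). y - \<tau> *\<^sub>R b) ` ({0..t} \<times> cball c (DIM('a) * d))"
  proof
    fix x assume "x \<in> S"
    then obtain \<tau> where "\<tau> \<in> {0..t}" "x + \<tau> *\<^sub>R b \<in> cball c (DIM('a) * d)"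
      by (auto simp: S_def dist_norm algebra_simps)
    then show "x \<in> (\<lambda>(\<tau>, y). y - \<tau> *\<^sub>R b) ` ({0..t} \<times> cball c (DIM('a) * d))"
      by (intro image_eqI[of _ _ "(\<tau>, x + \<tau> *\<^sub>R b)"]) auto
  qed
  ultimately obtain p where p: "S \<subseteq> cbox (- p) p"
    using bounded_subset bounded_subset_cbox_symmetric by meson
  have zero: "bump c d (x + \<tau> *\<^sub>R b) = 0" "dbump b c d (x + \<tau> *\<^sub>R b) = 0"
    if "x \<notin> cbox (- p) p" "\<tau> \<in> {0..t}" for x \<tau>
  proof -
    have "cball (c - \<tau> *\<^sub>R b) (DIM('a) * d) \<subseteq> S" unfolding S_def using that(2) by (rule UN_upper)
    then have x: "x \<notin> cball (c - \<tau> *\<^sub>R b) (DIM('a) * d)" using that(1) p by blast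
    show "bump c d (x + \<tau> *\<^sub>R b) = 0" unfolding bump_translate using x by (rule bump_zero_outside)
    show "dbump b c d (x + \<tau> *\<^sub>R b) = 0" unfolding dbump_translate using x by (rule dbump_zero_outside)
  qed
  note cont = continuous_on_compose2[OF continuous_bump] continuous_on_compose2[OF continuous_dbump]
    continuous_on_compose2[OF u]
  define I where "I \<tau> = integral (cbox (- p) p) (\<lambda>x. bump c d (x + \<tau> *\<^sub>R b) * u x)" for \<tau>
  define I' where "I' \<tau> = integral (cbox (- p) p) (\<lambda>x. dbump b c d (x + \<tau> *\<^sub>R b) * u x)" for \<tau>
  have I: "I \<tau> = (LINT x|lborel. bump c d (x + \<tau> *\<^sub>R b) * u x)" if "\<tau> \<in> {0..t}" for \<tau>
    unfolding I_def using that zero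
    by (intro lint_eq_integral_cbox[symmetric]) (auto intro!: continuous_intros cont)
  have I': "\<bar>I' \<tau>\<bar> \<le> A" if "\<tau> \<in> {0..t}" for \<tau>
  proof -
    have "I' \<tau> = (LINT x|lborel. dbump b c d (x + \<tau> *\<^sub>R b) * u x)"
      unfolding I'_def using that zero
      by (intro lint_eq_integral_cbox[symmetric]) (auto intro!: continuous_intros cont)
    then show ?thesis using der by simp
  qed
  have "(I has_vector_derivative I' \<tau>) (at \<tau> within {0..t})" if "\<tau> \<in> {0..t}" for \<tau>
    unfolding I_def I'_def
  proof (rule leibniz_rule_vector_derivative)
    fix \<tau> x
    have "((\<lambda>\<tau>. x + \<tau> *\<^sub>R b) has_derivative (\<lambda>h. h *\<^sub>R b)) (at \<tau> within {0..t})"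
      by (auto intro!: derivative_eq_intros)
    from has_derivative_compose[OF this bump_has_derivative]
    have "((\<lambda>\<tau>. bump c d (x + \<tau> *\<^sub>R b)) has_vector_derivative dbump b c d (x + \<tau> *\<^sub>R b)) (at \<tau> within {0..t})"
      by (simp add: has_vector_derivative_def linear_scale[OF has_derivative_linear[OF bump_has_derivative]])
    then show "((\<lambda>\<tau>. bump c d (x + \<tau> *\<^sub>R b) * u x) has_vector_derivative dbump b c d (x + \<tau> *\<^sub>R b) * u x)
        (at \<tau> within {0..t})"
      by (rule has_vector_derivative_mult_left)
  next
    show "(\<lambda>x. bump c d (x + \<tau> *\<^sub>R b) * u x) integrable_on cbox (- p) p" for \<tau>
      by (intro integrable_continuous continuous_intros cont) auto
    show "continuous_on ({0..t} \<times> cbox (- p) p) (\<lambda>(\<tau>, x). dbump b c d (x + \<tau> *\<^sub>R b) * u x)"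
      unfolding split_beta by (intro continuous_intros cont) auto
  qed (use that in auto)
  then have "\<exists>\<tau>\<in>{0..t}. I t - I 0 = (t - 0) *\<^sub>R I' \<tau>"
    using mvt_very_simple[OF \<open>t \<ge> 0\<close>, of I "\<lambda>\<tau> h. h *\<^sub>R I' \<tau>"] by (simp add: has_vector_derivative_def)
  then obtain \<tau> where "\<tau> \<in> {0..t}" "I t - I 0 = t * I' \<tau>" by auto
  then have "\<bar>I t - I 0\<bar> \<le> A * t"
    using mult_right_mono[OF I'[of \<tau>] \<open>t \<ge> 0\<close>] \<open>t \<ge> 0\<close> by (simp add: abs_mult mult.commute)
  then show ?thesis using I[of t] I[of 0] \<open>t \<ge> 0\<close> by simp
qed

text \<open>The estimate is derived for the second differences \<open>w\<close> of \<open>K\<close>, which are continuous, and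
passes to the gradient only at the end, by differentiation at a given point. This gives the
Lipschitz bound at every point although the hypotheses on the gradient hold almost everywhere.\<close>
lemma grad_lipschitz_in_direction:
  fixes K :: "'a::euclidean_space \<Rightarrow> real"
  assumes diff: "K differentiable_on UNIV" and f: "L_infty (grad K)"
    and g: "g \<in> borel_measurable lebesgue" "AE x in lebesgue. norm (g x) \<le> C" "weak_dir_deriv (grad K) b g"
    and "C \<ge> 0" "t \<ge> 0"
  shows "norm (grad K (y - t *\<^sub>R b) - grad K y) \<le> C * t"
proof -
  have contK: "continuous_on UNIV K" using diff by (rule differentiable_imp_continuous_on)
  note contK' = continuous_on_compose2[OF contK]
  obtain M where M: "AE x in lebesgue. norm (grad K x) \<le> M" using f by (auto simp: L_infty_def)
  \<comment> \<open>Testing the difference of gradients with itself turns the directional bound into one for its norm.\<close>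
  define e where "e = grad K (y - t *\<^sub>R b) - grad K y"
  define J where "J d = (LINT x|lborel. bump y d x)" for d
  have second: "\<bar>(K (y - t *\<^sub>R b + s *\<^sub>R e) - K (y - t *\<^sub>R b)) - (K (y + s *\<^sub>R e) - K y)\<bar> \<le> C * norm e * s * t"
    if "s \<ge> 0" for s
  proof -
    define u where "u x = K (x + s *\<^sub>R e) - K x" for x
    define w where "w x = u (x - t *\<^sub>R b) - u x" for x
    have u: "continuous_on UNIV u" unfolding u_def by (intro continuous_intros contK') auto
    have w: "continuous_on UNIV w"
      unfolding w_def by (intro continuous_intros continuous_on_compose2[OF u]) auto
    have w_avg: "\<bar>LINT x|lborel. bump y d x * w x\<bar> \<le> C * norm e * s * t * J d" for d
    proof -
      have "\<bar>LINT x|lborel. dbump b y d (x + \<tau> *\<^sub>R b) * u x\<bar> \<le> C * norm e * J d * s" for \<tau>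
        unfolding u_def
      proof (rule weighted_increment_bound[where S="cball (y - \<tau> *\<^sub>R b) (DIM('a) * d)"])
        show "(\<lambda>x. grad K x \<bullet> e) \<in> borel_measurable borel"
          by (rule borel_measurable_grad_inner[OF diff])
        have "AE x in lborel. norm (grad K x) \<le> M" using M by (simp add: AE_completion_iff)
        then show "AE x in lborel. \<bar>grad K x \<bullet> e\<bar> \<le> M * norm e"
          by eventually_elim (meson Cauchy_Schwarz_ineq2 mult_right_mono norm_ge_zero order_trans)
        show "continuous_on UNIV (\<lambda>x. dbump b y d (x + \<tau> *\<^sub>R b))"
          by (intro continuous_intros continuous_on_compose2[OF continuous_dbump]) auto
        show "dbump b y d (x + \<tau> *\<^sub>R b) = 0" if "x \<notin> cball (y - \<tau> *\<^sub>R b) (DIM('a) * d)" for x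
          unfolding dbump_translate using that by (rule dbump_zero_outside)
        show "\<bar>LINT x|lborel. dbump b y d (x + \<tau> *\<^sub>R b) * (grad K (x + r *\<^sub>R e) \<bullet> e)\<bar> \<le> C * norm e * J d" for r
        proof -
          \<comment> \<open>Shifting the variable of integration moves the shift from the gradient to the bump,
            where it only changes the centre.\<close>
          let ?h = "\<lambda>x. dbump b y d (x - r *\<^sub>R e + \<tau> *\<^sub>R b) * (grad K x \<bullet> e)"
          have "?h = (\<lambda>x. dbump b (y - (\<tau> *\<^sub>R b - r *\<^sub>R e)) d x * (grad K x \<bullet> e))"
            unfolding dbump_translate[symmetric] by (simp add: add_diff_eq diff_add_eq)
          moreover have "?h \<in> borel_measurable borel"
            by (intro borel_measurable_times borel_measurable_grad_inner[OF diff]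
                borel_measurable_continuous_onI continuous_on_compose2[OF continuous_dbump] continuous_intros) auto
          then have "(LINT x|lborel. ?h (x + r *\<^sub>R e)) = (LINT x|lborel. ?h x)"
            by (rule lborel_integral_translate)
          ultimately show ?thesis
            using weak_derivative_bound[OF f borel_measurable_grad_inner[OF diff] g,
                where c="y - (\<tau> *\<^sub>R b - r *\<^sub>R e)" and d=d and e=e]
            by (simp add: bump_integral_translate J_def)
        qed
      qed (use contK has_vector_derivative_along_line[OF diff] \<open>s \<ge> 0\<close> in auto)
      from bump_translation_bound[OF u \<open>t \<ge> 0\<close> this]
      have "\<bar>(LINT x|lborel. bump y d (x + t *\<^sub>R b) * u x) - (LINT x|lborel. bump y d x * u x)\<bar>
          \<le> C * norm e * J d * s * t" .
      moreover have "(LINT x|lborel. bump y d (x + t *\<^sub>R b) * u x) = (LINT x|lborel. bump y d x * u (x - t *\<^sub>R b))"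
        using lborel_integral_translate[of "\<lambda>x. bump y d x * u (x - t *\<^sub>R b)" "t *\<^sub>R b"]
        by (simp add: borel_measurable_continuous_onI continuous_intros continuous_bump continuous_on_compose2[OF u])
      moreover have "(LINT x|lborel. bump y d x * u (x - t *\<^sub>R b)) - (LINT x|lborel. bump y d x * u x)
          = (LINT x|lborel. bump y d x * w x)"
      proof -
        have "integrable lborel (\<lambda>x. bump y d x * v x)" if "continuous_on UNIV v" for v
          by (rule integrable_compact_support[OF _ compact_cball[of y "DIM('a) * d"]])
             (auto intro!: continuous_intros continuous_bump that simp: bump_zero_outside)
        moreover have "continuous_on UNIV (\<lambda>x. u (x - t *\<^sub>R b))"
          by (intro continuous_intros continuous_on_compose2[OF u]) auto
        ultimately show ?thesis
          using u by (subst Bochner_Integration.integral_diff[symmetric]) (auto simp: w_def right_diff_distrib)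
      qed
      ultimately show ?thesis by (simp add: mult_ac)
    qed
    have "w y \<le> C * norm e * s * t"
      using w by (rule bump_average_bound) (use abs_le_D1[OF w_avg] in \<open>simp add: J_def\<close>)
    moreover have "- w y \<le> C * norm e * s * t"
      using continuous_on_minus[OF w]
      by (rule bump_average_bound) (use abs_le_D2[OF w_avg] in \<open>simp add: J_def\<close>)
    ultimately show ?thesis by (simp add: w_def u_def abs_le_iff)
  qed
  have lim: "((\<lambda>s. (K (z + s *\<^sub>R e) - K z) / s) \<longlongrightarrow> grad K z \<bullet> e) (at_right 0)" for z
  proof -
    have "((\<lambda>s. (K (z + s *\<^sub>R e) - K z) / s) \<longlongrightarrow> grad K z \<bullet> e) (at 0)"
      using has_vector_derivative_along_line[OF diff, of z e 0 UNIV]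
      by (simp add: has_real_derivative_iff_has_vector_derivative[symmetric] DERIV_def)
    then show ?thesis by (rule filterlim_mono) (auto intro: at_le)
  qed
  have "((\<lambda>s. (K (y - t *\<^sub>R b + s *\<^sub>R e) - K (y - t *\<^sub>R b)) / s - (K (y + s *\<^sub>R e) - K y) / s)
      \<longlongrightarrow> grad K (y - t *\<^sub>R b) \<bullet> e - grad K y \<bullet> e) (at_right 0)"
    by (intro tendsto_diff lim)
  then have "grad K (y - t *\<^sub>R b) \<bullet> e - grad K y \<bullet> e \<le> C * norm e * t"
  proof (rule tendsto_upperbound)
    show "\<forall>\<^sub>F s in at_right 0. (K (y - t *\<^sub>R b + s *\<^sub>R e) - K (y - t *\<^sub>R b)) / s - (K (y + s *\<^sub>R e) - K y) / s
        \<le> C * norm e * t"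
      using eventually_at_right_less[of "0::real"]
    proof eventually_elim
      case (elim s)
      then show ?case
        using abs_le_D1[OF second[of s]] by (simp add: diff_divide_distrib[symmetric] pos_divide_le_eq mult_ac)
    qed
  qed simp
  then have "norm e * norm e \<le> (C * t) * norm e"
    by (simp add: e_def inner_diff_left[symmetric] power2_norm_eq_inner[symmetric] power2_eq_square mult_ac)
  moreover have "0 \<le> C * t"
    using \<open>C \<ge> 0\<close> \<open>t \<ge> 0\<close> by simp
  ultimately have "norm e \<le> C * t" by (cases "norm e = 0") (auto simp: mult_le_cancel_right)
  then show ?thesis by (simp add: e_def)
qed

lemma L_infty_nonneg_bound:
  assumes "L_infty f"
  obtains C where "C \<ge> 0" "AE x in lebesgue. norm (f x) \<le> C"
proof -
  obtain C where "AE x in lebesgue. norm (f x) \<le> C" using assms by (auto simp: L_infty_def)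
  then have "AE x in lebesgue. norm (f x) \<le> max C 0" by (rule eventually_mono) simp
  then show ?thesis by (intro that[of "max C 0"]) auto
qed

text \<open>Walk from \<open>y\<close> to \<open>x\<close> along the coordinate directions, one at a time.\<close>
lemma lipschitz_if_lipschitz_along_axes:
  fixes f :: "'a::euclidean_space \<Rightarrow> 'b::real_normed_vector"
  assumes C: "\<And>b y t. b \<in> Basis \<Longrightarrow> norm (f (y + t *\<^sub>R b) - f y) \<le> C b * \<bar>t\<bar>"
    and C_nonneg: "\<And>b. b \<in> Basis \<Longrightarrow> C b \<ge> 0"
  shows "norm (f x - f y) \<le> (\<Sum>b\<in>Basis. C b) * norm (x - y)"
proof -
  have partial: "norm (f (y + (\<Sum>b\<in>B. ((x - y) \<bullet> b) *\<^sub>R b)) - f y) \<le> (\<Sum>b\<in>B. C b * \<bar>(x - y) \<bullet> b\<bar>)"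
    if "finite B" "B \<subseteq> Basis" for B :: "'a set"
    using that
  proof (induction B)
    case (insert b B)
    let ?z = "y + (\<Sum>b\<in>B. ((x - y) \<bullet> b) *\<^sub>R b)"
    have "f (y + (\<Sum>b\<in>insert b B. ((x - y) \<bullet> b) *\<^sub>R b)) - f y =
        (f (?z + ((x - y) \<bullet> b) *\<^sub>R b) - f ?z) + (f ?z - f y)"
      using insert.hyps by (simp add: ac_simps)
    then have "norm (f (y + (\<Sum>b\<in>insert b B. ((x - y) \<bullet> b) *\<^sub>R b)) - f y)
        \<le> norm (f (?z + ((x - y) \<bullet> b) *\<^sub>R b) - f ?z) + norm (f ?z - f y)"
      by (simp only: norm_triangle_ineq)
    also have "\<dots> \<le> C b * \<bar>(x - y) \<bullet> b\<bar> + (\<Sum>b\<in>B. C b * \<bar>(x - y) \<bullet> b\<bar>)"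
    proof (rule add_mono)
      show "norm (f (?z + ((x - y) \<bullet> b) *\<^sub>R b) - f ?z) \<le> C b * \<bar>(x - y) \<bullet> b\<bar>"
        using insert.prems by (intro C) simp
      show "norm (f ?z - f y) \<le> (\<Sum>b\<in>B. C b * \<bar>(x - y) \<bullet> b\<bar>)"
        using insert.prems by (intro insert.IH) simp
    qed
    finally show ?case using insert.hyps by simp
  qed simp
  have "y + (\<Sum>b\<in>Basis. ((x - y) \<bullet> b) *\<^sub>R b) = x"
    by (subst euclidean_representation) simp
  then have "norm (f x - f y) \<le> (\<Sum>b\<in>Basis. C b * \<bar>(x - y) \<bullet> b\<bar>)"
    using partial[OF finite_Basis order_refl] by simp
  also have "\<dots> \<le> (\<Sum>b\<in>Basis. C b * norm (x - y))"
    by (rule sum_mono) (simp add: C_nonneg Basis_le_norm mult_left_mono)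
  finally show ?thesis by (simp add: sum_distrib_right)
qed

text \<open>The set where the bound fails is open and null.\<close>
lemma bounded_everywhere_if_AE_bounded:
  fixes f :: "'a::euclidean_space \<Rightarrow> 'b::real_normed_vector"
  assumes "continuous_on UNIV f" "AE x in lebesgue. norm (f x) \<le> M"
  shows "norm (f x) \<le> M"
proof -
  have op: "open {x. M < norm (f x)}"
    using assms(1) by (intro open_Collect_less continuous_intros)
  have "AE x in lebesgue. x \<notin> {x. M < norm (f x)}"
    using assms(2) by eventually_elim auto
  then have "{x. M < norm (f x)} \<in> null_sets lebesgue"
    using op by (subst AE_iff_null_sets) auto
  then have "negligible {x. M < norm (f x)}" by (simp add: negligible_iff_null_sets)
  then have "{x. M < norm (f x)} = {}" using open_not_negligible[OF op] by blast
  then show ?thesis by (auto simp: not_less[symmetric])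
qed

text \<open>Everywhere differentiability of \<open>K\<close> removes the exceptional null sets of the Sobolev
condition: each weak partial derivative yields a Lipschitz bound along one axis, and continuity
then upgrades the almost-everywhere bound on the gradient.\<close>
lemma grad_lipschitz_bounded:
  fixes K :: "'a::euclidean_space \<Rightarrow> real"
  assumes diff: "K differentiable_on UNIV" and W: "W_1_infty (grad K)"
  obtains L M where "L \<ge> 0" "\<And>x y. norm (grad K x - grad K y) \<le> L * norm (x - y)"
    "\<And>x. norm (grad K x) \<le> M"
proof -
  have f: "L_infty (grad K)" using W by (simp add: W_1_infty_def)
  have "\<exists>C\<ge>0. \<forall>y. \<forall>t\<ge>0. norm (grad K (y - t *\<^sub>R b) - grad K y) \<le> C * t" if "b \<in> Basis" for b
  proof -
    obtain g where g: "L_infty g" "weak_dir_deriv (grad K) b g"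
      using W \<open>b \<in> Basis\<close> by (auto simp: W_1_infty_def)
    obtain C where C: "C \<ge> 0" "AE x in lebesgue. norm (g x) \<le> C"
      using L_infty_nonneg_bound[OF g(1)] by blast
    have "g \<in> borel_measurable lebesgue" using g(1) by (simp add: L_infty_def)
    from grad_lipschitz_in_direction[OF diff f this C(2) g(2) C(1)] C(1) show ?thesis by blast
  qed
  then obtain C where C: "\<And>b. b \<in> Basis \<Longrightarrow> C b \<ge> 0"
      "\<And>b y t. b \<in> Basis \<Longrightarrow> t \<ge> 0 \<Longrightarrow> norm (grad K (y - t *\<^sub>R b) - grad K y) \<le> C b * t"
    by metis
  have lip: "norm (grad K x - grad K y) \<le> (\<Sum>b\<in>Basis. C b) * norm (x - y)" for x y
  proof (rule lipschitz_if_lipschitz_along_axes)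
    fix b y :: 'a and t :: real assume b: "b \<in> Basis"
    show "norm (grad K (y + t *\<^sub>R b) - grad K y) \<le> C b * \<bar>t\<bar>"
    proof (cases "t \<ge> 0")
      case True
      with C(2)[OF b True, of "y + t *\<^sub>R b"] show ?thesis by (simp add: norm_minus_commute)
    next
      case False
      with C(2)[OF b, of "- t" y] show ?thesis by simp
    qed
  qed (rule C(1))
  have nonneg: "(\<Sum>b\<in>Basis. C b) \<ge> 0" using C(1) by (rule sum_nonneg)
  have "continuous_on UNIV (grad K)"
    by (rule lipschitz_on_continuous_on[of "\<Sum>b\<in>Basis. C b"])
       (use lip nonneg in \<open>auto simp: lipschitz_on_def dist_norm\<close>)
  moreover obtain M where "AE x in lebesgue. norm (grad K x) \<le> M"
    using f by (auto simp: L_infty_def)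
  ultimately have "norm (grad K x) \<le> M" for x
    by (rule bounded_everywhere_if_AE_bounded)
  from that[OF nonneg lip this] show ?thesis .
qed

section \<open>Relaxation towards a bounded Lipschitz field\<close>

text \<open>Gronwall's inequality with a source, for a rate \<open>a\<close> of either sign: positive \<open>a\<close> is relaxation
towards \<open>b\<close>, negative \<open>a\<close> is controlled growth. The function \<open>exp (a * s) * (u s - b)\<close> is
nonincreasing.\<close>
lemma exponential_decay_bound:
  fixes u :: "real \<Rightarrow> real"
  assumes "r \<le> t"
    and der: "\<And>s. s \<in> {r..t} \<Longrightarrow> (u has_real_derivative u' s) (at s within {r..t})"
    and le: "\<And>s. s \<in> {r..t} \<Longrightarrow> u' s \<le> - a * (u s - b)"
  shows "u t \<le> b + exp (- a * (t - r)) * (u r - b)"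
proof -
  define g where "g s = exp (a * s) * (u s - b)" for s
  have "(g has_real_derivative exp (a * s) * (a * (u s - b) + u' s)) (at s within {r..t})"
    if "s \<in> {r..t}" for s
    unfolding g_def using der[OF that] by (auto intro!: derivative_eq_intros simp: algebra_simps)
  then obtain s where s: "s \<in> {r..t}"
      "g t - g r = exp (a * s) * (a * (u s - b) + u' s) * (t - r)"
    using mvt_very_simple[OF \<open>r \<le> t\<close>, of g "\<lambda>s h. exp (a * s) * (a * (u s - b) + u' s) * h"]
    by (auto simp: has_field_derivative_def)
  have "exp (a * s) * (a * (u s - b) + u' s) * (t - r) \<le> 0"
    using le[OF s(1)] \<open>r \<le> t\<close> by (intro mult_nonpos_nonneg mult_nonneg_nonpos) auto
  then have "g t \<le> g r" using s by linarith
  then have "exp (- a * t) * g t \<le> exp (- a * t) * g r" by (rule mult_left_mono) simp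
  moreover have "exp (- a * t) * g t = u t - b"
    by (simp add: g_def mult.assoc[symmetric] exp_add[symmetric])
  moreover have "exp (- a * t) * g r = exp (- a * (t - r)) * (u r - b)"
    by (simp add: g_def mult.assoc[symmetric] exp_add[symmetric] right_diff_distrib)
  ultimately show ?thesis by linarith
qed

lemma has_vector_derivative_norm_square:
  fixes f :: "real \<Rightarrow> 'a::real_inner"
  assumes "(f has_vector_derivative f') (at s within S)"
  shows "((\<lambda>s. (norm (f s))\<^sup>2) has_real_derivative 2 * (f s \<bullet> f')) (at s within S)"
proof -
  have "((\<lambda>s. f s \<bullet> f s) has_derivative (\<lambda>h. f s \<bullet> (h *\<^sub>R f') + (h *\<^sub>R f') \<bullet> f s)) (at s within S)"
    using has_derivative_inner[OF assms[unfolded has_vector_derivative_def] assms[unfolded has_vector_derivative_def]] .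
  then show ?thesis
    unfolding has_field_derivative_def power2_norm_eq_inner
    by (rule has_derivative_eq_rhs) (auto simp: inner_commute)
qed

lemma has_vector_derivative_vec:
  fixes f :: "real \<Rightarrow> ('a::euclidean_space)^'n"
  assumes "\<And>i. ((\<lambda>s. f s $ i) has_vector_derivative f' $ i) (at t within S)"
  shows "(f has_vector_derivative f') (at t within S)"
  unfolding has_vector_derivative_def
proof (subst has_derivative_componentwise_within, intro ballI)
  fix b :: "'a^'n" assume "b \<in> Basis"
  then obtain i u where b: "b = axis i u" by (auto simp: Basis_vec_def)
  have "((\<lambda>s. f s $ i \<bullet> u) has_derivative (\<lambda>h. (h *\<^sub>R f' $ i) \<bullet> u)) (at t within S)"
    using assms[of i] unfolding has_vector_derivative_def by (auto intro!: derivative_eq_intros)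
  then show "((\<lambda>x. f x \<bullet> b) has_derivative (\<lambda>x. x *\<^sub>R f' \<bullet> b)) (at t within S)"
    by (simp add: b inner_axis)
qed

text \<open>Both systems with the particle structure hidden in the field \<open>F\<close>: the estimates compare whole
configurations in one Euclidean norm.\<close>
locale relaxation =
  fixes F :: "'a::euclidean_space \<Rightarrow> 'a" and L M t0 T :: real and x :: "real \<Rightarrow> 'a"
    and x0 v0 :: 'a and xe ve :: "real \<Rightarrow> real \<Rightarrow> 'a"
  assumes L: "L \<ge> 0" and lip: "\<And>p q. norm (F p - F q) \<le> L * norm (p - q)"
    and bound: "\<And>p. norm (F p) \<le> M"
    and x: "\<And>t. t \<in> {t0..T} \<Longrightarrow> (x has_vector_derivative F (x t)) (at t within {t0..T})"
    and xe: "\<And>\<epsilon> t. \<epsilon> > 0 \<Longrightarrow> t \<in> {t0..T} \<Longrightarrow>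
      (xe \<epsilon> has_vector_derivative ve \<epsilon> t) (at t within {t0..T})"
    and ve: "\<And>\<epsilon> t. \<epsilon> > 0 \<Longrightarrow> t \<in> {t0..T} \<Longrightarrow>
      (ve \<epsilon> has_vector_derivative (F (xe \<epsilon> t) - ve \<epsilon> t) /\<^sub>R \<epsilon>) (at t within {t0..T})"
    and x_init: "x t0 = x0" and xe_init: "\<And>\<epsilon>. \<epsilon> > 0 \<Longrightarrow> xe \<epsilon> t0 = x0"
    and ve_init: "\<And>\<epsilon>. \<epsilon> > 0 \<Longrightarrow> ve \<epsilon> t0 = v0"
begin

text \<open>Estimates use squared norms, which are differentiable everywhere. With \<open>w = v - a\<close> and
\<open>g = F - a\<close>, the identity \<open>2 w \<bullet> (g - w) = |g|\<^sup>2 - |w|\<^sup>2 - |g - w|\<^sup>2\<close> shows the decay.\<close>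
lemma relax_derivative:
  assumes "\<epsilon> > 0" "t0 \<le> r" "t \<le> T" "s \<in> {r..t}" 
  obtains u' where "((\<lambda>s. (norm (ve \<epsilon> s - a))\<^sup>2) has_real_derivative u') (at s within {r..t})"
    and "u' \<le> - (1 / \<epsilon>) * ((norm (ve \<epsilon> s - a))\<^sup>2 - (norm (F (xe \<epsilon> s) - a))\<^sup>2)"
proof -
  let ?w = "ve \<epsilon> s - a" and ?g = "F (xe \<epsilon> s) - a"
  have "((\<lambda>s. ve \<epsilon> s - a) has_vector_derivative (?g - ?w) /\<^sub>R \<epsilon>) (at s within {t0..T})"
    using ve[of \<epsilon> s] assms by (auto intro!: derivative_eq_intros)
  then have "((\<lambda>s. ve \<epsilon> s - a) has_vector_derivative (?g - ?w) /\<^sub>R \<epsilon>) (at s within {r..t})"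
    by (rule has_vector_derivative_within_subset) (use assms in auto)
  note has_vector_derivative_norm_square[OF this]
  moreover have "0 \<le> (norm (?g - ?w))\<^sup>2" by simp
  then have "2 * (?w \<bullet> (?g - ?w)) \<le> (norm ?g)\<^sup>2 - (norm ?w)\<^sup>2"
    unfolding power2_norm_eq_inner inner_diff_left inner_diff_right by (simp add: inner_commute)
  then have "2 * (?w \<bullet> (?g - ?w)) / \<epsilon> \<le> ((norm ?g)\<^sup>2 - (norm ?w)\<^sup>2) / \<epsilon>"
    using assms by (intro divide_right_mono) auto
  then have "2 * (?w \<bullet> ((?g - ?w) /\<^sub>R \<epsilon>)) \<le> - (1 / \<epsilon>) * ((norm ?w)\<^sup>2 - (norm ?g)\<^sup>2)"
    by (simp add: divide_inverse algebra_simps)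
  ultimately show ?thesis by (rule that)
qed

text \<open>A bound on the velocities uniform in \<open>\<epsilon>\<close> and in time: \<open>|ve|\<^sup>2\<close> relaxes from \<open>|v0|\<^sup>2\<close> towards at most \<open>M\<^sup>2\<close>,
so it stays below their sum. The sum, unlike the sharper maximum, also dominates \<open>|v0|\<close> and \<open>M\<close>
without case distinctions.\<close>
definition V where "V = sqrt ((norm v0)\<^sup>2 + M\<^sup>2)"

lemma V_nonneg: "V \<ge> 0" and V_sq: "V\<^sup>2 = (norm v0)\<^sup>2 + M\<^sup>2"
  by (auto simp: V_def)

text \<open>Used twice: with \<open>a = 0\<close> to bound the velocity, and with \<open>a = F (x t)\<close> on a short interval
ending at \<open>t\<close> to obtain its limit. Fixing \<open>a\<close> in time keeps the comparison differentiable, which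
\<open>F (x s)\<close> need not be for a merely Lipschitz \<open>F\<close>.\<close>
lemma relax_bound:
  assumes "\<epsilon> > 0" "t0 \<le> r" "r \<le> t" "t \<le> T"
    and "\<And>s. s \<in> {r..t} \<Longrightarrow> norm (F (xe \<epsilon> s) - a) \<le> \<eta>"
  shows "(norm (ve \<epsilon> t - a))\<^sup>2 \<le> \<eta>\<^sup>2 + exp (- (1 / \<epsilon>) * (t - r)) * ((norm (ve \<epsilon> r - a))\<^sup>2 - \<eta>\<^sup>2)"
proof -
  have "\<exists>u'. ((\<lambda>s. (norm (ve \<epsilon> s - a))\<^sup>2) has_real_derivative u') (at s within {r..t}) \<and>
    u' \<le> - (1 / \<epsilon>) * ((norm (ve \<epsilon> s - a))\<^sup>2 - \<eta>\<^sup>2)" if s: "s \<in> {r..t}" for s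
  proof -
    have "(norm (F (xe \<epsilon> s) - a))\<^sup>2 \<le> \<eta>\<^sup>2"
      using assms(5)[OF s] by (intro power_mono) auto
    then have "(1 / \<epsilon>) * (norm (F (xe \<epsilon> s) - a))\<^sup>2 \<le> (1 / \<epsilon>) * \<eta>\<^sup>2"
      using assms(1) by (intro mult_left_mono) auto
    then show ?thesis
      using relax_derivative[OF assms(1,2,4) s, of a] by (smt (verit) right_diff_distrib minus_mult_left)
  qed
  then obtain u' where "\<And>s. s \<in> {r..t} \<Longrightarrow>
      ((\<lambda>s. (norm (ve \<epsilon> s - a))\<^sup>2) has_real_derivative u' s) (at s within {r..t}) \<and>
      u' s \<le> - (1 / \<epsilon>) * ((norm (ve \<epsilon> s - a))\<^sup>2 - \<eta>\<^sup>2)"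
    by metis
  then show ?thesis by (intro exponential_decay_bound[OF assms(3)]) auto
qed

lemma ve_bound:
  assumes "\<epsilon> > 0" "t \<in> {t0..T}"
  shows "norm (ve \<epsilon> t) \<le> V"
proof -
  have "(norm (ve \<epsilon> t))\<^sup>2 \<le> M\<^sup>2 + exp (- (1 / \<epsilon>) * (t - t0)) * ((norm v0)\<^sup>2 - M\<^sup>2)"
    using relax_bound[of \<epsilon> t0 t 0 M] assms bound by (auto simp: ve_init)
  also have "\<dots> \<le> M\<^sup>2 + (norm v0)\<^sup>2"
  proof -
    have "exp (- (1 / \<epsilon>) * (t - t0)) * ((norm v0)\<^sup>2 - M\<^sup>2) \<le>
        exp (- (1 / \<epsilon>) * (t - t0)) * (norm v0)\<^sup>2"
      by (intro mult_left_mono) auto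
    also have "\<dots> \<le> 1 * (norm v0)\<^sup>2"
      using assms by (intro mult_right_mono) auto
    finally show ?thesis by simp
  qed
  also have "\<dots> = V\<^sup>2" by (simp add: V_sq)
  finally show ?thesis by (rule power2_le_imp_le) (rule V_nonneg)
qed

text \<open>The corrected position \<open>xe + \<epsilon> ve\<close> is driven by \<open>F\<close> alone, without the fast relaxation term, so
its distance \<open>z\<close> to the limit obeys a Gronwall inequality whose constants do not blow up
as \<open>\<epsilon>\<close> tends to \<open>0\<close>.\<close>
lemma position_error:
  assumes "\<epsilon> > 0" "t \<in> {t0..T}"
  shows "norm (xe \<epsilon> t - x t) \<le> \<epsilon> * (V + sqrt (2 * exp (3 * L * (T - t0))) * V)"
proof -
  define z where "z s = xe \<epsilon> s + \<epsilon> *\<^sub>R ve \<epsilon> s - x s" for s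
  define u where "u s = (norm (z s))\<^sup>2" for s
  define u' where "u' s = 2 * (z s \<bullet> (F (xe \<epsilon> s) - F (x s)))" for s
  \<comment> \<open>The equilibrium \<open>-(\<epsilon> V)\<^sup>2\<close> and the rate \<open>3 L\<close> come from \<open>2 |z| (|z| + \<epsilon> V) \<le> 3 (|z|\<^sup>2 + (\<epsilon> V)\<^sup>2)\<close>.\<close>
  have "u t \<le> - (\<epsilon> * V)\<^sup>2 + exp (- (- 3 * L) * (t - t0)) * (u t0 - (- (\<epsilon> * V)\<^sup>2))"
  proof (rule exponential_decay_bound)
    show "t0 \<le> t" using assms by simp
    fix s assume "s \<in> {t0..t}"
    then have s: "s \<in> {t0..T}" using assms by auto
    have "(z has_vector_derivative F (xe \<epsilon> s) - F (x s)) (at s within {t0..T})"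
      unfolding z_def using xe[OF assms(1) s] ve[OF assms(1) s] x[OF s] assms(1)
      by (auto intro!: derivative_eq_intros)
    from has_vector_derivative_norm_square[OF has_vector_derivative_within_subset[OF this]]
    show "(u has_real_derivative u' s) (at s within {t0..t})"
      unfolding u_def u'_def using assms(2) by simp
    have "xe \<epsilon> s - x s = z s - \<epsilon> *\<^sub>R ve \<epsilon> s" by (simp add: z_def)
    then have "norm (xe \<epsilon> s - x s) \<le> norm (z s) + \<epsilon> * V"
      using norm_triangle_ineq4[of "z s" "\<epsilon> *\<^sub>R ve \<epsilon> s"] ve_bound[OF assms(1) s] assms(1)
      by (smt (verit) mult_left_mono norm_scaleR)
    then have F: "norm (F (xe \<epsilon> s) - F (x s)) \<le> L * (norm (z s) + \<epsilon> * V)"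
      using lip[of "xe \<epsilon> s" "x s"] mult_left_mono[OF _ L] order_trans by blast
    have "z s \<bullet> (F (xe \<epsilon> s) - F (x s)) \<le> norm (z s) * norm (F (xe \<epsilon> s) - F (x s))"
      by (rule norm_cauchy_schwarz)
    also have "\<dots> \<le> norm (z s) * (L * (norm (z s) + \<epsilon> * V))"
      using F by (intro mult_left_mono) auto
    finally have "u' s \<le> L * (2 * (norm (z s))\<^sup>2 + 2 * norm (z s) * (\<epsilon> * V))"
      by (simp add: u'_def algebra_simps power2_eq_square)
    also have "\<dots> \<le> L * (3 * (norm (z s))\<^sup>2 + (\<epsilon> * V)\<^sup>2)"
      using sum_squares_bound[of "norm (z s)" "\<epsilon> * V"] by (intro mult_left_mono[OF _ L]) auto
    also have "\<dots> \<le> L * (3 * (norm (z s))\<^sup>2 + 3 * (\<epsilon> * V)\<^sup>2)"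
      by (intro mult_left_mono[OF _ L]) auto
    also have "\<dots> = - (- 3 * L) * (u s - (- (\<epsilon> * V)\<^sup>2))"
      by (simp add: u_def algebra_simps)
    finally show "u' s \<le> - (- 3 * L) * (u s - (- (\<epsilon> * V)\<^sup>2))" .
  qed
  moreover have "u t0 \<le> (\<epsilon> * V)\<^sup>2"
  proof -
    have "norm v0 \<le> V" by (rule power2_le_imp_le) (auto simp: V_sq V_nonneg)
    then show ?thesis
      using assms by (auto simp: u_def z_def x_init xe_init ve_init intro!: power_mono)
  qed
  moreover have "exp (- (- 3 * L) * (t - t0)) \<le> exp (3 * L * (T - t0))"
    using assms L by (auto intro: mult_left_mono)
  ultimately have "u t \<le> exp (3 * L * (T - t0)) * ((\<epsilon> * V)\<^sup>2 + (\<epsilon> * V)\<^sup>2)"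
    by (smt (verit) exp_ge_zero mult_mono u_def zero_le_power2)
  also have "\<dots> = (\<epsilon> * (sqrt (2 * exp (3 * L * (T - t0))) * V))\<^sup>2"
    by (simp add: power_mult_distrib)
  finally have "norm (z t) \<le> \<epsilon> * (sqrt (2 * exp (3 * L * (T - t0))) * V)"
    unfolding u_def by (rule power2_le_imp_le) (use assms V_nonneg in auto)
  moreover have "norm (xe \<epsilon> t - x t) \<le> norm (z t) + \<epsilon> * V"
  proof -
    have "xe \<epsilon> t - x t = z t - \<epsilon> *\<^sub>R ve \<epsilon> t" by (simp add: z_def)
    then show ?thesis
      using norm_triangle_ineq4[of "z t" "\<epsilon> *\<^sub>R ve \<epsilon> t"] ve_bound[OF assms] assms(1)
      by (smt (verit) mult_left_mono norm_scaleR)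
  qed
  ultimately show ?thesis by (simp add: algebra_simps)
qed

lemma position_limit:
  assumes "t \<in> {t0..T}"
  shows "((\<lambda>\<epsilon>. xe \<epsilon> t) \<longlongrightarrow> x t) (at_right 0)"
proof -
  let ?C = "V + sqrt (2 * exp (3 * L * (T - t0))) * V"
  have "((\<lambda>\<epsilon>. \<epsilon> * ?C) \<longlongrightarrow> 0) (at_right 0)"
    by (intro tendsto_mult_left_zero tendsto_ident_at)
  moreover have "\<forall>\<^sub>F \<epsilon> in at_right 0. norm (xe \<epsilon> t - x t) \<le> \<epsilon> * ?C"
    using eventually_at_right_less[of "0::real"]
    by (rule eventually_mono) (rule position_error[OF _ assms])
  ultimately have "((\<lambda>\<epsilon>. xe \<epsilon> t - x t) \<longlongrightarrow> 0) (at_right 0)"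
    by (rule Lim_null_comparison[rotated])
  then show ?thesis by (rule LIM_zero_cancel)
qed

text \<open>On the short interval \<open>{r..t}\<close> the target \<open>F (xe s)\<close> stays within \<open>\<eta> < e\<close> of \<open>F (x t)\<close>: half of
\<open>\<eta>\<close> is spent on the position error, half on the continuity of \<open>x\<close>. Since \<open>r < t\<close> is independent
of \<open>\<epsilon>\<close>, the contribution of the velocity at time \<open>r\<close> vanishes exponentially. This is where
\<open>t0 < t\<close> is needed.\<close>
lemma velocity_limit:
  assumes "t0 < t" "t \<le> T"
  shows "((\<lambda>\<epsilon>. ve \<epsilon> t) \<longlongrightarrow> F (x t)) (at_right 0)"
proof (rule tendstoI)
  fix e :: real assume "e > 0"
  let ?C = "V + sqrt (2 * exp (3 * L * (T - t0))) * V"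
  define \<eta> where "\<eta> = e / 2"
  have \<eta>: "\<eta> > 0" "\<eta> < e" using \<open>e > 0\<close> by (auto simp: \<eta>_def)
  have "continuous (at t within {t0..T}) x"
    by (rule has_vector_derivative_continuous[OF x]) (use assms in auto)
  moreover have "\<eta> / (2 * (L + 1)) > 0" using \<eta> L by auto
  ultimately obtain d where d: "d > 0"
      "\<And>s. s \<in> {t0..T} \<Longrightarrow> dist s t < d \<Longrightarrow> dist (x s) (x t) < \<eta> / (2 * (L + 1))"
    unfolding continuous_within_eps_delta by blast
  define r where "r = max t0 (t - d / 2)"
  have r: "t0 \<le> r" "r < t" "t - r < d" using d(1) assms by (auto simp: r_def)
  have "((\<lambda>\<epsilon>. L * (\<epsilon> * ?C)) \<longlongrightarrow> L * (0 * ?C)) (at_right 0)"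
    by (intro tendsto_intros)
  then have ev1: "\<forall>\<^sub>F \<epsilon> in at_right 0. L * (\<epsilon> * ?C) < \<eta> / 2"
    by (rule order_tendstoD) (use \<eta> in auto)
  have "filterlim (\<lambda>\<epsilon>::real. (t - r) * inverse \<epsilon>) at_top (at_right 0)"
    using r by (intro filterlim_tendsto_pos_mult_at_top[OF tendsto_const] filterlim_inverse_at_top_right) auto
  then have "((\<lambda>\<epsilon>. exp (- ((t - r) * inverse \<epsilon>))) \<longlongrightarrow> 0) (at_right 0)"
    by (intro filterlim_compose[OF exp_at_bot]) (simp add: filterlim_uminus_at_top[symmetric])
  then have "((\<lambda>\<epsilon>. \<eta>\<^sup>2 + exp (- ((t - r) * inverse \<epsilon>)) * (V + M)\<^sup>2) \<longlongrightarrow> \<eta>\<^sup>2 + 0 * (V + M)\<^sup>2) (at_right 0)"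
    by (intro tendsto_intros)
  then have ev2: "\<forall>\<^sub>F \<epsilon> in at_right 0. \<eta>\<^sup>2 + exp (- ((t - r) * inverse \<epsilon>)) * (V + M)\<^sup>2 < e\<^sup>2"
    by (rule order_tendstoD) (use \<eta> in \<open>auto intro: power_strict_mono\<close>)
  have ev3: "\<forall>\<^sub>F \<epsilon> in at_right 0. (\<epsilon>::real) > 0" by (simp add: eventually_at_filter)
  from ev1 ev2 ev3 show "\<forall>\<^sub>F \<epsilon> in at_right 0. dist (ve \<epsilon> t) (F (x t)) < e"
  proof eventually_elim
    case (elim \<epsilon>)
    have close: "norm (F (xe \<epsilon> s) - F (x t)) \<le> \<eta>" if "s \<in> {r..t}" for s
    proof -
      have s: "s \<in> {t0..T}" "dist s t < d" using that r assms by (auto simp: dist_real_def)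
      have "norm (F (xe \<epsilon> s) - F (x s)) \<le> L * (\<epsilon> * ?C)"
        using lip[of "xe \<epsilon> s" "x s"] mult_left_mono[OF position_error[OF elim(3) s(1)] L] by linarith
      moreover have "norm (F (x s) - F (x t)) \<le> \<eta> / 2"
      proof -
        have "norm (F (x s) - F (x t)) \<le> L * norm (x s - x t)" by (rule lip)
        also have "\<dots> \<le> (L + 1) * (\<eta> / (2 * (L + 1)))"
          using d(2)[OF s] L by (intro mult_mono) (auto simp: dist_norm)
        also have "\<dots> = \<eta> / 2" using L by (simp add: field_simps)
        finally show ?thesis .
      qed
      ultimately show ?thesis
        using elim(1) norm_triangle_ineq[of "F (xe \<epsilon> s) - F (x s)" "F (x s) - F (x t)"] by simp
    qed
    have "(norm (ve \<epsilon> t - F (x t)))\<^sup>2 \<le>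
        \<eta>\<^sup>2 + exp (- (1 / \<epsilon>) * (t - r)) * ((norm (ve \<epsilon> r - F (x t)))\<^sup>2 - \<eta>\<^sup>2)"
      using elim(3) r assms close by (intro relax_bound) auto
    also have "\<dots> \<le> \<eta>\<^sup>2 + exp (- (1 / \<epsilon>) * (t - r)) * (V + M)\<^sup>2"
    proof -
      have "norm (ve \<epsilon> r - F (x t)) \<le> V + M"
        using norm_triangle_ineq4[of "ve \<epsilon> r" "F (x t)"] ve_bound[of \<epsilon> r] bound[of "x t"] elim(3) r assms
        by auto
      then have "(norm (ve \<epsilon> r - F (x t)))\<^sup>2 \<le> (V + M)\<^sup>2" by (intro power_mono) auto
      then show ?thesis by (intro add_left_mono mult_left_mono) (auto intro: order_trans[rotated])
    qed
    also have "\<dots> < e\<^sup>2" using elim(2) by (simp add: divide_inverse mult.commute)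
    finally show ?case
      using \<open>e > 0\<close> power2_less_imp_less[of "norm (ve \<epsilon> t - F (x t))" e] by (simp add: dist_norm)
  qed
qed

end

section \<open>The particle systems\<close>

text \<open>Crude constants suffice: one factor \<open>N\<close> bounds a configuration by its components, the other
bounds the sum of pair forces (its prefactor \<open>1/N\<close> is estimated by \<open>1\<close>), and \<open>2\<close> appears because both
particles of a pair move.\<close>
lemma velocity_lipschitz_bounded:
  fixes K :: "real^'d \<Rightarrow> real"
  assumes L: "L \<ge> 0" and lip: "\<And>x y. norm (grad K x - grad K y) \<le> L * norm (x - y)"
    and M: "\<And>x. norm (grad K x) \<le> M"
  obtains L' M' where "L' \<ge> 0"
    "\<And>x y :: (real^'d)^'n. norm (velocity K x - velocity K y) \<le> L' * norm (x - y)"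
    "\<And>x :: (real^'d)^'n. norm (velocity K x) \<le> M'"
proof
  let ?N = "real CARD('n)"
  show "?N * (?N * (2 * L)) \<ge> 0" using L by simp
  fix x y :: "(real^'d)^'n"
  have avg: "norm (- ((1 / ?N) *\<^sub>R (\<Sum>j\<in>UNIV - {i}. h j))) \<le> ?N * B"
    if "\<And>j. norm (h j) \<le> B" for h :: "'n \<Rightarrow> real^'d" and i :: 'n and B
  proof -
    have "norm (\<Sum>j\<in>UNIV - {i}. h j) \<le> (\<Sum>j\<in>UNIV - {i}. B)"
      using that by (intro sum_norm_le) auto
    also have "\<dots> \<le> (\<Sum>j\<in>(UNIV::'n set). B)"
      using order_trans[OF norm_ge_zero that] by (intro sum_mono2) auto
    finally have *: "norm (\<Sum>j\<in>UNIV - {i}. h j) \<le> ?N * B" by simp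
    have "norm (- ((1 / ?N) *\<^sub>R (\<Sum>j\<in>UNIV - {i}. h j))) \<le> 1 * norm (\<Sum>j\<in>UNIV - {i}. h j)"
      unfolding norm_minus_cancel norm_scaleR by (intro mult_right_mono) (auto simp: Suc_le_eq)
    then show ?thesis using * by simp
  qed
  have vec: "norm z \<le> ?N * B" if "\<And>i. norm (z $ i) \<le> B" for z :: "(real^'d)^'n" and B
  proof -
    have "norm z \<le> (\<Sum>i\<in>UNIV. norm (z $ i))"
      unfolding norm_vec_def by (rule L2_set_le_sum) simp
    also have "\<dots> \<le> (\<Sum>i\<in>(UNIV::'n set). B)" by (intro sum_mono that)
    finally show ?thesis by simp
  qed
  show "norm (velocity K x) \<le> ?N * (?N * M)"
    by (rule vec) (simp only: velocity_def vec_lambda_beta avg M)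
  have comp: "norm (x $ i - y $ i) \<le> norm (x - y)" for i
    using Finite_Cartesian_Product.norm_nth_le[of "x - y" i] by simp
  have summand: "norm (grad K (x $ i - x $ j) - grad K (y $ i - y $ j)) \<le> 2 * L * norm (x - y)" for i j
  proof -
    have "norm ((x $ i - x $ j) - (y $ i - y $ j)) = norm ((x $ i - y $ i) - (x $ j - y $ j))"
      by (simp add: algebra_simps)
    also have "\<dots> \<le> 2 * norm (x - y)"
      using norm_triangle_ineq4[of "x $ i - y $ i" "x $ j - y $ j"] comp[of i] comp[of j] by linarith
    finally show ?thesis
      using lip[of "x $ i - x $ j" "y $ i - y $ j"] mult_left_mono[OF _ L] by (fastforce simp: mult_ac)
  qed
  have "norm (velocity K x - velocity K y) \<le> ?N * (?N * (2 * L * norm (x - y)))"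
  proof (rule vec)
    fix i
    have "(velocity K x - velocity K y) $ i =
      - ((1 / ?N) *\<^sub>R (\<Sum>j\<in>UNIV - {i}. grad K (x $ i - x $ j) - grad K (y $ i - y $ j)))"
      by (simp add: velocity_def sum_subtractf scaleR_diff_right)
    then show "norm ((velocity K x - velocity K y) $ i) \<le> ?N * (2 * L * norm (x - y))"
      using avg[OF summand] by simp
  qed
  then show "norm (velocity K x - velocity K y) \<le> ?N * (?N * (2 * L)) * norm (x - y)"
    by (simp add: mult_ac)
qed

theorem theorem2p2:
  fixes K :: "real^'d \<Rightarrow> real"
    and t0 T :: real
    and x0 v0 :: "(real^'d)^'n"
    and x v :: "real \<Rightarrow> (real^'d)^'n"
    and xe ve :: "real \<Rightarrow> real \<Rightarrow> (real^'d)^'n"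
  assumes "t0 < T"
    and "radial K"
    and "K differentiable_on UNIV"
    and "W_1_infty (grad K)"
    and "first_order_solution K t0 T x"
    and "x t0 = x0"
    and "\<And>t. t \<in> {t0..T} \<Longrightarrow> v t = velocity K (x t)"
    and "\<And>\<epsilon>. \<epsilon> > 0 \<Longrightarrow> second_order_solution K \<epsilon> t0 T (xe \<epsilon>) (ve \<epsilon>)"
    and "\<And>\<epsilon>. \<epsilon> > 0 \<Longrightarrow> xe \<epsilon> t0 = x0 \<and> ve \<epsilon> t0 = v0"
  shows "(\<exists>T'. t0 < T' \<and> T' < T \<and>
           (\<forall>t\<in>{t0<..T'}. ((\<lambda>\<epsilon>. ve \<epsilon> t) \<longlongrightarrow> v t) (at_right 0)) \<and>
           (\<forall>t\<in>{t0..T'}. ((\<lambda>\<epsilon>. xe \<epsilon> t) \<longlongrightarrow> x t) (at_right 0))) \<and>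
         (((\<lambda>\<epsilon>. ve \<epsilon> t0) \<longlongrightarrow> v t0) (at_right 0) \<longleftrightarrow>
            (\<forall>i. v0 $ i =
               - ((1 / real CARD('n)) *\<^sub>R (\<Sum>j\<in>UNIV - {i}. grad K (x0 $ i - x0 $ j)))))"
proof
  obtain L M where "L \<ge> 0" "\<And>x y. norm (grad K x - grad K y) \<le> L * norm (x - y)"
      "\<And>x. norm (grad K x) \<le> M"
    using grad_lipschitz_bounded[OF assms(3,4)] by blast
  then obtain L' M' where L': "L' \<ge> 0"
      "\<And>x y :: (real^'d)^'n. norm (velocity K x - velocity K y) \<le> L' * norm (x - y)"
      "\<And>x :: (real^'d)^'n. norm (velocity K x) \<le> M'"
    using velocity_lipschitz_bounded[where 'n='n] by metis
  interpret relaxation "velocity K" L' M' t0 T x x0 v0 xe ve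
  proof
    show "(x has_vector_derivative velocity K (x t)) (at t within {t0..T})" if "t \<in> {t0..T}" for t
      using assms(5) that by (intro has_vector_derivative_vec[of x]) (auto simp: first_order_solution_def)
    fix \<epsilon> t :: real assume pos: "\<epsilon> > 0" and t: "t \<in> {t0..T}"
    have sol: "((\<lambda>s. xe \<epsilon> s $ i) has_vector_derivative ve \<epsilon> t $ i) (at t within {t0..T}) \<and>
        (\<exists>a. ((\<lambda>s. ve \<epsilon> s $ i) has_vector_derivative a) (at t within {t0..T}) \<and>
             \<epsilon> *\<^sub>R a = velocity K (xe \<epsilon> t) $ i - ve \<epsilon> t $ i)" for i
      using assms(8)[OF pos] t by (simp add: second_order_solution_def velocity_def minus_diff_commute)
    show "(xe \<epsilon> has_vector_derivative ve \<epsilon> t) (at t within {t0..T})"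
      using sol by (intro has_vector_derivative_vec[of "xe \<epsilon>"]) auto
    show "(ve \<epsilon> has_vector_derivative (velocity K (xe \<epsilon> t) - ve \<epsilon> t) /\<^sub>R \<epsilon>) (at t within {t0..T})"
    proof (rule has_vector_derivative_vec)
      fix i
      obtain a where a: "((\<lambda>s. ve \<epsilon> s $ i) has_vector_derivative a) (at t within {t0..T})"
          "\<epsilon> *\<^sub>R a = velocity K (xe \<epsilon> t) $ i - ve \<epsilon> t $ i"
        using sol[of i] by blast
      have "a = (\<epsilon> *\<^sub>R a) /\<^sub>R \<epsilon>" using pos by simp
      then show "((\<lambda>s. ve \<epsilon> s $ i) has_vector_derivative ((velocity K (xe \<epsilon> t) - ve \<epsilon> t) /\<^sub>R \<epsilon>) $ i)
          (at t within {t0..T})"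
        using a by simp
    qed
  qed (use L' assms(6,9) in auto)
  \<comment> \<open>Convergence holds on all of \<open>{t0..T}\<close>; any interior time will do.\<close>
  define T' where "T' = (t0 + T) / 2"
  have "t0 < T'" "T' < T" using \<open>t0 < T\<close> by (auto simp: T'_def)
  moreover have "((\<lambda>\<epsilon>. ve \<epsilon> t) \<longlongrightarrow> v t) (at_right 0)" if "t \<in> {t0<..T'}" for t
    using velocity_limit[of t] assms(7)[of t] that \<open>T' < T\<close> by auto
  moreover have "((\<lambda>\<epsilon>. xe \<epsilon> t) \<longlongrightarrow> x t) (at_right 0)" if "t \<in> {t0..T'}" for t
    using position_limit[of t] that \<open>T' < T\<close> by auto
  ultimately show "\<exists>T'. t0 < T' \<and> T' < T \<and>
      (\<forall>t\<in>{t0<..T'}. ((\<lambda>\<epsilon>. ve \<epsilon> t) \<longlongrightarrow> v t) (at_right 0)) \<and>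
      (\<forall>t\<in>{t0..T'}. ((\<lambda>\<epsilon>. xe \<epsilon> t) \<longlongrightarrow> x t) (at_right 0))"
    by blast
next
  have "\<forall>\<^sub>F \<epsilon> in at_right 0. ve \<epsilon> t0 = v0"
    using eventually_at_right_less[of "0::real"] by (rule eventually_mono) (simp add: assms(9))
  then have "((\<lambda>\<epsilon>. ve \<epsilon> t0) \<longlongrightarrow> v t0) (at_right 0) \<longleftrightarrow> ((\<lambda>\<epsilon>. v0) \<longlongrightarrow> v t0) (at_right (0::real))"
    by (rule tendsto_cong)
  also have "\<dots> \<longleftrightarrow> v0 = velocity K x0"
    using assms(1,6) assms(7)[of t0] by (simp add: tendsto_const_iff)
  finally show "((\<lambda>\<epsilon>. ve \<epsilon> t0) \<longlongrightarrow> v t0) (at_right 0) \<longleftrightarrow>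
      (\<forall>i. v0 $ i = - ((1 / real CARD('n)) *\<^sub>R (\<Sum>j\<in>UNIV - {i}. grad K (x0 $ i - x0 $ j))))"
    by (simp add: vec_eq_iff velocity_def)
qed

end
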